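(* Every convergent sequence $(\pi_n,\mu_n)_{n=1}^\infty$ of $\square$-graphons (where the underlying measurable space $(X_n,\mathcal A_n)$ may vary with $n$) has a limit. That is: if for every $k\in\mathbb N$ the sequence of $k$-shapes $\big(\mathbb S_k(\pi_n,\mu_n)\big)_{n=1}^\infty$ is convergent in $\mathcal K_k$, then there exist a measurable space $(X,\mathcal A)$ and a $\square$-graphon $(\pi,\mu)$ on $(X,\mathcal A)$ such that, for every $k\in\mathbb N$, the sequence $\big(\mathbb S_k(\pi_n,\mu_n)\big)_{n=1}^\infty$ converges to $\mathbb S_k(\pi,\mu)$ in $\mathcal K_k$.
   Context: A $\square$-graphon on a measurable space $(X,\mathcal A)$ is a pair $(\pi,\mu)$, where $\pi$ is a probability measure on $(X,\mathcal A)$ and $\mu$ is a finite measure on $(X,\mathcal A)^2=(X^2,\mathcal A^2)$, with $\mathcal A^2$ the product $\sigma$-algebra. A Markov kernel from $(X,\mathcal A)$ to $(Y,\mathcal B)$ is a map $\kappa\colon X\times\mathcal B\to[0,1]$ such that $\kappa(x,\cdot)$ is a probability measure on $(Y,\mathcal B)$ for every $x\in X$ and $\kappa(\cdot,B)$ is measurable for every $B\in\mathcal B$. The Markov kernel $\kappa^{\otimes 2}$ from $(X,\mathcal A)^2$ to $(Y,\mathcal B)^2$ is given by $\kappa^{\otimes 2}((x_1,x_2),\widetilde B)=(\kappa(x_1,\cdot)\times\kappa(x_2,\cdot))(\widetilde B)$ (product measure). For a measure $\pi$ on $(X,\mathcal A)$, the pushforward along $\kappa$ is the measure $\kappa_*\pi(B)=\int_X\kappa(x,B)\,d\pi(x)$,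 $B\in\mathcal B$. A morphism from a $\square$-graphon $(\pi_X,\mu_X)$ on $(X,\mathcal A)$ to a $\square$-graphon $(\pi_Y,\mu_Y)$ on $(Y,\mathcal B)$ is a Markov kernel $\kappa$ from $(X,\mathcal A)$ to $(Y,\mathcal B)$ with $\kappa_*\pi_X=\pi_Y$ and $\kappa^{\otimes2}_*\mu_X=\mu_Y$. For $k\in\mathbb N$ let $[k]=\{1,\dots,k\}$ and $\mathcal F_k=([k],2^{[k]})$. The set of all $\square$-graphons $(\rho,\nu)$ on $\mathcal F_k$ is identified with a subset of $\mathbb R^{[k]\cup[k]^2}$ via the values $\rho(\{i\})$, $i\in[k]$, and $\nu(\{(i,j)\})$, $(i,j)\in[k]^2$, and carries the subspace topology. For a $\square$-graphon $(\pi,\mu)$, $(\pi,\mu)^\downarrow_k$ is the set of all $\square$-graphons on $\mathcal F_k$ to which there is a morphism from $(\pi,\mu)$; the $k$-shape $\mathbb S_k(\pi,\mu)$ is the closure of $(\pi,\mu)^\downarrow_k$ in the space of all $\square$-graphons on $\mathcal F_k$ (it is always a nonempty compact set). $\mathcal K_k$ is the space of all nonempty compact subsets of the space of all $\square$-graphons on $\mathcal F_k$, with the Vietoris topology. *)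

theory Defs
  imports "HOL-Probability.Probability"
begin

text \<open>A measurable space \<open>(X, \<A>)\<close> is represented by a value \<open>M :: 'a measure\<close>, of which only
  \<open>space M\<close> and \<open>sets M\<close> are used.\<close>

definition square_graphon :: "'a measure \<Rightarrow> 'a measure \<Rightarrow> ('a \<times> 'a) measure \<Rightarrow> bool" where
  "square_graphon M \<pi> \<mu> \<longleftrightarrow>
     prob_space \<pi> \<and> sets \<pi> = sets M \<and>
     finite_measure \<mu> \<and> sets \<mu> = sets (M \<Otimes>\<^sub>M M)"

text \<open>Markov kernels from \<open>M\<close> to \<open>N\<close> are the elements of \<open>M \<rightarrow>\<^sub>M prob_algebra N\<close>, and the
  pushforward of a measure \<open>\<pi>\<close> along \<open>\<kappa>\<close> is \<open>\<pi> \<bind> \<kappa>\<close>. The next two lemmas give the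
  elementary description of both notions.\<close>

lemma markov_kernel_iff:
  "\<kappa> \<in> M \<rightarrow>\<^sub>M prob_algebra N \<longleftrightarrow>
     (\<forall>x\<in>space M. prob_space (\<kappa> x) \<and> sets (\<kappa> x) = sets N) \<and>
     (\<forall>B\<in>sets N. (\<lambda>x. emeasure (\<kappa> x) B) \<in> borel_measurable M)"
proof (intro iffI conjI ballI)
  assume \<kappa>: "\<kappa> \<in> M \<rightarrow>\<^sub>M prob_algebra N"
  fix x assume "x \<in> space M"
  from measurable_space[OF \<kappa> this] show "prob_space (\<kappa> x)" "sets (\<kappa> x) = sets N"
    by (auto simp: space_prob_algebra)
next
  fix B assume \<kappa>: "\<kappa> \<in> M \<rightarrow>\<^sub>M prob_algebra N" and B: "B \<in> sets N"
  show "(\<lambda>x. emeasure (\<kappa> x) B) \<in> borel_measurable M"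
    using measurable_emeasure_kernel[OF measurable_prob_algebraD[OF \<kappa>] B] .
next
  assume *: "(\<forall>x\<in>space M. prob_space (\<kappa> x) \<and> sets (\<kappa> x) = sets N) \<and>
     (\<forall>B\<in>sets N. (\<lambda>x. emeasure (\<kappa> x) B) \<in> borel_measurable M)"
  show "\<kappa> \<in> M \<rightarrow>\<^sub>M prob_algebra N"
    using * by (intro measurable_prob_algebraI measurable_subprob_algebra)
      (auto simp: prob_space_imp_subprob_space)
qed

lemma emeasure_pushforward:
  assumes "space \<pi> \<noteq> {}" "sets \<pi> = sets M" "\<kappa> \<in> M \<rightarrow>\<^sub>M prob_algebra N" "B \<in> sets N"
  shows "emeasure (\<pi> \<bind> \<kappa>) B = (\<integral>\<^sup>+x. emeasure (\<kappa> x) B \<partial>\<pi>)"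
proof (rule emeasure_bind)
  show "\<kappa> \<in> \<pi> \<rightarrow>\<^sub>M subprob_algebra N"
    using measurable_prob_algebraD[OF assms(3)] assms(2)
    by (simp cong: measurable_cong_sets)
qed (use assms in auto)

definition kernel_square ::
    "('a \<Rightarrow> 'b measure) \<Rightarrow> 'a \<times> 'a \<Rightarrow> ('b \<times> 'b) measure" where
  "kernel_square \<kappa> = (\<lambda>(x\<^sub>1, x\<^sub>2). \<kappa> x\<^sub>1 \<Otimes>\<^sub>M \<kappa> x\<^sub>2)"

lemma kernel_square_measurable:
  assumes [measurable]: "\<kappa> \<in> M \<rightarrow>\<^sub>M prob_algebra N"
  shows "kernel_square \<kappa> \<in> M \<Otimes>\<^sub>M M \<rightarrow>\<^sub>M prob_algebra (N \<Otimes>\<^sub>M N)"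
  unfolding kernel_square_def by measurable

definition graphon_morphism ::
    "'a measure \<Rightarrow> 'a measure \<Rightarrow> ('a \<times> 'a) measure \<Rightarrow>
     'b measure \<Rightarrow> 'b measure \<Rightarrow> ('b \<times> 'b) measure \<Rightarrow> ('a \<Rightarrow> 'b measure) \<Rightarrow> bool" where
  "graphon_morphism M \<pi>\<^sub>X \<mu>\<^sub>X N \<pi>\<^sub>Y \<mu>\<^sub>Y \<kappa> \<longleftrightarrow>
     \<kappa> \<in> M \<rightarrow>\<^sub>M prob_algebra N \<and>
     \<pi>\<^sub>X \<bind> \<kappa> = \<pi>\<^sub>Y \<and>
     \<mu>\<^sub>X \<bind> kernel_square \<kappa> = \<mu>\<^sub>Y"

abbreviation fin_space :: "nat \<Rightarrow> nat measure" where
  "fin_space k \<equiv> count_space {1..k}"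

definition fin_graphons :: "nat \<Rightarrow> (nat measure \<times> (nat \<times> nat) measure) set" where
  "fin_graphons k = {(\<rho>, \<nu>). square_graphon (fin_space k) \<rho> \<nu>}"

text \<open>The index set \<open>[k] \<union> [k]\<^sup>2\<close> is the disjoint union inside \<open>nat + nat \<times> nat\<close>.\<close>

definition coord_index :: "nat \<Rightarrow> (nat + nat \<times> nat) set" where
  "coord_index k = {1..k} <+> {1..k} \<times> {1..k}"

definition graphon_coords ::
    "nat \<Rightarrow> nat measure \<times> (nat \<times> nat) measure \<Rightarrow> (nat + nat \<times> nat \<Rightarrow> real)" where
  "graphon_coords k = (\<lambda>(\<rho>, \<nu>).
     restrict (case_sum (\<lambda>i. measure \<rho> {i}) (\<lambda>p. measure \<nu> {p})) (coord_index k))"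

definition fin_graphon_topology :: "nat \<Rightarrow> (nat measure \<times> (nat \<times> nat) measure) topology" where
  "fin_graphon_topology k =
     pullback_topology (fin_graphons k) (graphon_coords k) (powertop_real (coord_index k))"

lemma topspace_fin_graphon_topology: "topspace (fin_graphon_topology k) = fin_graphons k"
  by (auto simp: fin_graphon_topology_def topspace_pullback_topology graphon_coords_def)

definition down_set ::
    "nat \<Rightarrow> 'a measure \<Rightarrow> 'a measure \<Rightarrow> ('a \<times> 'a) measure \<Rightarrow>
     (nat measure \<times> (nat \<times> nat) measure) set" where
  "down_set k M \<pi> \<mu> =
     {(\<rho>, \<nu>). (\<rho>, \<nu>) \<in> fin_graphons k \<and>
       (\<exists>\<kappa>. graphon_morphism M \<pi> \<mu> (fin_space k) \<rho> \<nu> \<kappa>)}"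

definition shape ::
    "nat \<Rightarrow> 'a measure \<Rightarrow> 'a measure \<Rightarrow> ('a \<times> 'a) measure \<Rightarrow>
     (nat measure \<times> (nat \<times> nat) measure) set" where
  "shape k M \<pi> \<mu> = fin_graphon_topology k closure_of down_set k M \<pi> \<mu>"

text \<open>The Vietoris topology on the nonempty compact subsets of \<open>T\<close>, generated by the sets
  \<open>{K. K \<subseteq> U}\<close> and \<open>{K. K \<inter> U \<noteq> {}}\<close> with \<open>U\<close> open.\<close>

definition compact_subsets :: "'a topology \<Rightarrow> 'a set set" where
  "compact_subsets T = {K. compactin T K \<and> K \<noteq> {}}"

definition vietoris :: "'a topology \<Rightarrow> 'a set topology" where
  "vietoris T = topology_generated_by
     ({{K \<in> compact_subsets T. K \<subseteq> U} |U. openin T U} \<union>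
      {{K \<in> compact_subsets T. K \<inter> U \<noteq> {}} |U. openin T U})"

lemma topspace_vietoris: "topspace (vietoris T) = compact_subsets T"
proof -
  have "compact_subsets T = {K \<in> compact_subsets T. K \<subseteq> topspace T}"
    by (auto simp: compact_subsets_def dest: compactin_subset_topspace)
  then show ?thesis
    unfolding vietoris_def topology_generated_by_topspace by blast
qed

abbreviation shape_space :: "nat \<Rightarrow> (nat measure \<times> (nat \<times> nat) measure) set topology" where
  "shape_space k \<equiv> vietoris (fin_graphon_topology k)"

end

theory Submission
  imports Defs
begin

text \<open>
The limit is built on a compact product of finite sets. A morphism to a graphon on \<open>[k]\<close> is a
measurable map into the probability simplex (\<open>total_coords_down_set\<close>), and rounding to a finite net of
the simplex turns it into a finite partition, with a small error in the coordinates of the quotient.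
Fix a countable basis of the coordinate space and, for each \<open>k\<close>, a sequence of finite nets whose mesh
tends to \<open>0\<close>; there are countably many pairs of a net and a basic open set. For each such pair and each \<open>n\<close>
choose a partition of \<open>X\<^sub>n\<close> whose quotient has its coordinates in that open set, if there is one. The
chosen partitions of \<open>X\<^sub>n\<close> are the coordinates of one map \<open>\<Phi>\<^sub>n\<close> from \<open>X\<^sub>n\<close> to a product \<open>\<Omega>\<close> of finite sets.

The total masses are bounded, as the \<open>1\<close>-shapes converge. By Tychonoff's theorem there is a filter \<open>G\<close>,
finer than the filter of the sequence, along which the pushforward measures converge on all clopen
subsets of \<open>\<Omega>\<close> and of \<open>\<Omega> \<times> \<Omega>\<close>. Compactness makes the limits countably additive on clopen sets, so that they
extend to a graphon \<open>(\<pi>', \<mu>')\<close> on \<open>\<Omega>\<close> (\<open>limit_graphon_exists\<close>).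

Let \<open>L\<close> be the limit of the \<open>k\<close>-shapes. It equals the \<open>k\<close>-shape of \<open>(\<pi>', \<mu>')\<close>:

\<^item> A point of \<open>L\<close> is approached by quotients of the graphons in the sequence, after rounding by the
chosen partitions. These partitions are pulled back from coordinate projections of \<open>\<Omega>\<close>, whose level sets
are clopen, so the corresponding quotients of \<open>(\<pi>', \<mu>')\<close> are limits along \<open>G\<close> and lie close to the point.

\<^item> A quotient of \<open>(\<pi>', \<mu>')\<close> is approximated by one that comes from a clopen step function
(\<open>approximate_by_clopen_step\<close>). The latter is a limit along \<open>G\<close> of quotients of the graphons in the
sequence, so it cannot be separated from \<open>L\<close> (\<open>down_set_limit_subset\<close>).
\<close>

section \<open>Compactness and measures on clopen sets\<close>

lemma compact_Pi_UNIV: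
  fixes K :: "'i \<Rightarrow> 'b::topological_space set"
  assumes "\<And>i. compact (K i)"
  shows "compact (Pi UNIV K)"
proof -
  have "compactin (product_topology (\<lambda>i. euclidean) UNIV) (PiE UNIV K)"
    using assms by (simp add: compactin_PiE)
  then show ?thesis
    by (simp add: euclidean_product_topology PiE_UNIV_domain)
qed

text \<open>By Tychonoff the values lie in a compact cube of functions, so the sequence has a cluster point
there. A filter finer than \<open>F\<close> along which the sequence tends to that point serves all indices at
once; it takes the place of a diagonal subsequence and works for an index type of any size.\<close>

lemma bounded_family_limit_filter:
  fixes g :: "nat \<Rightarrow> 'i \<Rightarrow> real"
  assumes F: "F \<noteq> bot" and bdd: "\<forall>\<^sub>F n in F. \<forall>i. 0 \<le> g n i \<and> g n i \<le> C"
  obtains G l where "G \<le> F" "G \<noteq> bot" "\<And>i. ((\<lambda>n. g n i) \<longlongrightarrow> l i) G"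
proof -
  let ?K = "Pi UNIV (\<lambda>i::'i. {0..C})"
  have "compact ?K"
    by (intro compact_Pi_UNIV) simp
  moreover have "filtermap g F \<noteq> bot"
    using F by (simp add: filtermap_bot_iff)
  moreover have "filtermap g F \<le> principal ?K"
    using bdd by (simp add: le_principal eventually_filtermap Pi_iff)
  ultimately obtain l where l: "inf (nhds l) (filtermap g F) \<noteq> bot"
    unfolding compact_filter le_principal by blast
  define G where "G = inf F (filtercomap g (nhds l))"
  have "G \<noteq> bot"
  proof
    assume "G = bot"
    then obtain P Q where P: "eventually P F" and Q: "eventually Q (filtercomap g (nhds l))"
      and PQ: "\<And>n. P n \<Longrightarrow> Q n \<Longrightarrow> False"
      unfolding G_def trivial_limit_def eventually_inf by auto
    from Q obtain R where R: "eventually R (nhds l)" "\<And>n. R (g n) \<Longrightarrow> Q n"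
      by (auto simp: eventually_filtercomap)
    have "eventually (\<lambda>y. \<not> R y) (filtermap g F)"
      using P by (auto simp: eventually_filtermap elim!: eventually_mono dest: PQ R(2))
    with R(1) have "eventually (\<lambda>_. False) (inf (nhds l) (filtermap g F))"
      unfolding eventually_inf by blast
    with l show False
      by (simp add: trivial_limit_def)
  qed
  moreover have "((\<lambda>n. g n i) \<longlongrightarrow> l i) G" for i
  proof -
    have "filterlim g (nhds l) G"
      unfolding G_def filterlim_iff_le_filtercomap by simp
    then have "(g \<longlongrightarrow> l) G" .
    then show ?thesis
      using continuous_on_tendsto_compose[OF continuous_on_product_coordinates[of i]] by auto
  qed
  ultimately show ?thesis
    using that[of G l] by (simp add: G_def)
qed

definition clopen_subsets :: "'a::topological_space set \<Rightarrow> 'a set set" where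
  "clopen_subsets \<Omega> = {A. A \<subseteq> \<Omega> \<and> closed A \<and> closed (\<Omega> - A)}"

lemma algebra_clopen_subsets:
  assumes "closed \<Omega>"
  shows "algebra \<Omega> (clopen_subsets \<Omega>)"
proof (rule algebra_iff_Un[THEN iffD2], intro conjI ballI)
  fix A B assume AB: "A \<in> clopen_subsets \<Omega>" "B \<in> clopen_subsets \<Omega>"
  have "\<Omega> - (A \<union> B) = (\<Omega> - A) \<inter> (\<Omega> - B)" by auto
  with AB show "A \<union> B \<in> clopen_subsets \<Omega>"
    by (auto simp: clopen_subsets_def)
next
  fix A assume A: "A \<in> clopen_subsets \<Omega>"
  then have "\<Omega> - (\<Omega> - A) = A" by (auto simp: clopen_subsets_def)
  with A show "\<Omega> - A \<in> clopen_subsets \<Omega>" by (auto simp: clopen_subsets_def)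
qed (use assms in \<open>auto simp: clopen_subsets_def\<close>)

text \<open>A finitely additive function on the clopen subsets of a compact set is automatically
continuous at \<open>{}\<close>: a decreasing sequence of nonempty clopen sets has nonempty intersection by
compactness, so a sequence with empty intersection becomes empty after finitely many steps.
Caratheodory's theorem then extends the function.\<close>

lemma clopen_subsets_extension:
  fixes \<Omega> :: "'a::t2_space set" and f :: "'a set \<Rightarrow> real"
  assumes \<Omega>: "compact \<Omega>"
    and nonneg: "\<And>A. A \<in> clopen_subsets \<Omega> \<Longrightarrow> 0 \<le> f A"
    and additive: "\<And>A B. A \<in> clopen_subsets \<Omega> \<Longrightarrow> B \<in> clopen_subsets \<Omega> \<Longrightarrow> A \<inter> B = {} \<Longrightarrow>
      f (A \<union> B) = f A + f B"
  obtains P where "finite_measure P" "sets P = sets (sigma \<Omega> (clopen_subsets \<Omega>))"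
    "\<And>A. A \<in> clopen_subsets \<Omega> \<Longrightarrow> measure P A = f A"
proof -
  let ?A = "clopen_subsets \<Omega>"
  interpret algebra \<Omega> ?A
    using \<Omega> by (intro algebra_clopen_subsets compact_imp_closed)
  have f0: "f {} = 0"
    using additive[of "{}" "{}"] by simp
  have "\<exists>m :: 'a set \<Rightarrow> ennreal. (\<forall>s\<in>?A. m s = ennreal (f s)) \<and>
      measure_space \<Omega> (sigma_sets \<Omega> ?A) m"
  proof (rule caratheodory_empty_continuous)
    show "positive ?A (\<lambda>s. ennreal (f s))"
      by (simp add: positive_def f0)
    show "additive ?A (\<lambda>s. ennreal (f s))"
      by (auto simp: Measure_Space.additive_def additive nonneg ennreal_plus)
  next
    fix A :: "nat \<Rightarrow> 'a set"
    assume A: "range A \<subseteq> ?A" "decseq A" "(\<Inter>i. A i) = {}"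
    have "\<exists>N. A N = {}"
    proof (rule ccontr)
      assume ne: "\<not> ?thesis"
      have "\<Omega> \<inter> \<Inter>(range A) \<noteq> {}"
      proof (rule compact_imp_fip[OF \<Omega>])
        show "closed T" if "T \<in> range A" for T
          using that A(1) by (auto simp: clopen_subsets_def)
        fix F' assume F': "finite F'" "F' \<subseteq> range A"
        then obtain J where J: "finite J" "F' = A ` J"
          by (metis finite_subset_image)
        have "A (Max (insert 0 J)) \<subseteq> A j" if "j \<in> J" for j
          using J that by (intro decseqD[OF A(2)] Max_ge) auto
        moreover have "A (Max (insert 0 J)) \<subseteq> \<Omega>" "A (Max (insert 0 J)) \<noteq> {}"
          using A(1) ne by (auto simp: clopen_subsets_def)
        ultimately show "\<Omega> \<inter> \<Inter>F' \<noteq> {}"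
          unfolding J by blast
      qed
      with A(3) show False by simp
    qed
    then obtain N where N: "A N = {}" ..
    have "A n = {}" if "n \<ge> N" for n
      using decseqD[OF A(2) that] N by auto
    then have "\<forall>\<^sub>F n in sequentially. ennreal (f (A n)) = 0"
      by (auto simp: eventually_sequentially f0 intro!: exI[of _ N])
    then show "(\<lambda>i. ennreal (f (A i))) \<longlonglongrightarrow> 0"
      by (rule tendsto_eventually)
  qed auto
  then obtain m where m: "\<And>s. s \<in> ?A \<Longrightarrow> m s = ennreal (f s)" "measure_space \<Omega> (sigma_sets \<Omega> ?A) m"
    by auto
  define P where "P = measure_of \<Omega> ?A m"
  have emP: "emeasure P A = ennreal (f A)" if "A \<in> ?A" for A
    using m that space_closed
    by (subst emeasure_measure_of[OF P_def])
      (auto simp: measure_space_def sets_measure_of P_def)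
  have sp: "space P = \<Omega>" "sets P = sigma_sets \<Omega> ?A"
    using space_closed by (auto simp: P_def sets_measure_of space_measure_of)
  show ?thesis
  proof
    show "finite_measure P"
      by (rule finite_measureI) (simp add: sp emP)
    show "sets P = sets (sigma \<Omega> ?A)"
      using space_closed by (simp add: sp)
    show "measure P A = f A" if "A \<in> ?A" for A
      using that by (simp add: measure_def emP nonneg)
  qed
qed

text \<open>The sets that can be approximated by members of the algebra form a \<open>\<sigma>\<close>-algebra. For countable
unions, a finite partial union has almost full measure, and the finitely many errors add up.\<close>

lemma (in finite_measure) approximate_by_algebra:
  assumes alg: "algebra (space M) \<A>" and sets: "sets M = sigma_sets (space M) \<A>"
    and A: "A \<in> sets M" and e: "0 < e"
  shows "\<exists>B\<in>\<A>. measure M (sym_diff A B) < e"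
proof -
  interpret algebra "space M" \<A> by fact
  have \<A>: "B \<in> sets M" if "B \<in> \<A>" for B
    using that by (simp add: sets)
  have "A \<in> sigma_sets (space M) \<A>"
    using A by (simp add: sets)
  then show ?thesis
    using e
  proof (induction arbitrary: e)
    case (Basic a)
    then show ?case by (intro bexI[of _ a]) auto
  next
    case Empty
    then show ?case by (intro bexI[of _ "{}"]) auto
  next
    case (Compl a)
    then obtain B where B: "B \<in> \<A>" "measure M (sym_diff a B) < e" by blast
    have "a \<subseteq> space M"
      using Compl.hyps sets sets.sets_into_space by blast
    then have "sym_diff (space M - a) (space M - B) = sym_diff a B"
      using B(1) space_closed by auto
    with B show ?case by (intro bexI[of _ "space M - B"]) auto
  next
    case (Union a)
    have a: "a i \<in> sets M" for i
      using Union.hyps by (simp add: sets)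
    have "(\<lambda>n. measure M (\<Union>i<n. a i)) \<longlonglongrightarrow> measure M (\<Union>n. \<Union>i<n. a i)"
      using a by (intro finite_Lim_measure_incseq) (force simp: incseq_def)+
    also have "(\<Union>n. \<Union>i<n. a i) = (\<Union>i. a i)" by auto
    finally have "\<forall>\<^sub>F n in sequentially. measure M (\<Union>i. a i) - e / 2 < measure M (\<Union>i<n. a i)"
      using \<open>0 < e\<close> by (intro order_tendstoD(1)) auto
    then obtain n where n: "measure M (\<Union>i. a i) - e / 2 < measure M (\<Union>i<n. a i)"
      by (auto simp: eventually_sequentially)
    have "\<exists>B\<in>\<A>. measure M (sym_diff (a i) B) < e / (2 * Suc n)" for i
      using \<open>0 < e\<close> by (intro Union.IH) auto
    then obtain B where B: "\<And>i. B i \<in> \<A>" "\<And>i. measure M (sym_diff (a i) (B i)) < e / (2 * Suc n)"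
      by metis
    let ?a = "\<Union>i. a i" and ?an = "\<Union>i<n. a i" and ?B = "\<Union>i<n. B i"
    have meas [measurable]: "?a \<in> sets M" "?an \<in> sets M" "\<And>i. B i \<in> sets M" "?B \<in> sets M" "\<And>i. a i \<in> sets M"
      using a \<A>[OF B(1)] by auto
    have "measure M (sym_diff ?a ?B) \<le> measure M ((?a - ?an) \<union> (\<Union>i<n. sym_diff (a i) (B i)))"
      by (intro finite_measure_mono) (auto 4 4)
    also have "\<dots> \<le> measure M (?a - ?an) + measure M (\<Union>i<n. sym_diff (a i) (B i))"
      by (intro measure_subadditive) auto
    also have "measure M (?a - ?an) < e / 2"
      using n by (subst finite_measure_Diff) auto
    also have "measure M (\<Union>i<n. sym_diff (a i) (B i)) \<le> (\<Sum>i<n. measure M (sym_diff (a i) (B i)))"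
      by (intro measure_subadditive_finite) auto
    also have "\<dots> \<le> (\<Sum>i<n. e / (2 * Suc n))"
      using B(2) by (intro sum_mono less_imp_le)
    also have "\<dots> \<le> e / 2"
      using \<open>0 < e\<close> by (simp add: field_simps)
    finally have "measure M (sym_diff ?a ?B) < e" by simp
    moreover have "?B \<in> \<A>" using B(1) by auto
    ultimately show ?case by blast
  qed
qed

text \<open>Each of the \<open>m\<close> level sets is approximated by a member of the algebra. These members need not be
disjoint or cover the space; sending a point to the first of them that contains it, and to the last
index if there is none, gives a function again, and it agrees with \<open>p\<close> off the symmetric differences.\<close>

lemma (in finite_measure) approximate_step_by_algebra:
  fixes p :: "'a \<Rightarrow> nat"
  assumes alg: "algebra (space M) \<A>" and sets: "sets M = sigma_sets (space M) \<A>"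
    and p: "p \<in> M \<rightarrow>\<^sub>M count_space UNIV" "\<And>x. x \<in> space M \<Longrightarrow> p x < m" and e: "0 < e"
    and m: "0 < m"
  obtains q where "\<And>x. x \<in> space M \<Longrightarrow> q x < m" "\<And>j. q -` {j} \<inter> space M \<in> \<A>"
    "measure M {x \<in> space M. p x \<noteq> q x} < e"
proof -
  obtain m' where Suc: "m = Suc m'" using m gr0_implies_Suc by blast
  interpret algebra "space M" \<A> by fact
  let ?F = "\<lambda>j. p -` {j} \<inter> space M"
  have F: "?F j \<in> sets M" for j
    by (rule measurable_sets[OF p(1)]) simp
  have "\<exists>B\<in>\<A>. measure M (sym_diff (?F j) B) < e / Suc m" for j
    using e by (intro approximate_by_algebra[OF alg sets F]) auto
  then obtain B where B: "\<And>j. B j \<in> \<A>" "\<And>j. measure M (sym_diff (?F j) (B j)) < e / Suc m"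
    by metis
  define B' where "B' j = (if m' \<le> j then space M else B j)" for j
  define q where "q x = (LEAST j. x \<in> B' j)" for x
  have q: "q x = j \<longleftrightarrow> x \<in> B' j \<and> (\<forall>i<j. x \<notin> B' i)" if x: "x \<in> space M" for x j
  proof -
    have "x \<in> B' m'" using x by (simp add: B'_def)
    then have *: "x \<in> B' (q x)" unfolding q_def by (rule LeastI)
    show ?thesis
    proof
      assume j: "q x = j"
      have "x \<notin> B' i" if "i < q x" for i
        using that unfolding q_def by (rule not_less_Least)
      with * j show "x \<in> B' j \<and> (\<forall>i<j. x \<notin> B' i)"
        by blast
    next
      assume "x \<in> B' j \<and> (\<forall>i<j. x \<notin> B' i)"
      then show "q x = j"
        unfolding q_def by (intro Least_equality) (auto intro!: leI)
    qed
  qed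
  have qm: "q x < m" if x: "x \<in> space M" for x
  proof -
    have "q x \<le> m'"
      unfolding q_def using x by (intro Least_le) (simp add: B'_def)
    then show ?thesis using Suc by simp
  qed
  have B'A: "B' j \<in> \<A>" for j using B(1) by (simp add: B'_def)
  have "B' j \<subseteq> space M" for j using B'A space_closed by blast
  with q have "q -` {j} \<inter> space M = B' j - (\<Union>i<j. B' i)" for j
    by blast
  then have qA: "q -` {j} \<inter> space M \<in> \<A>" for j
    using B'A by (auto intro!: Diff finite_UN)
  have Bs: "B j \<in> sets M" for j using B(1) by (simp add: sets)
  have "{x \<in> space M. p x \<noteq> q x} \<subseteq> (\<Union>j<m. sym_diff (?F j) (B j))"
  proof
    fix x assume x: "x \<in> {x \<in> space M. p x \<noteq> q x}"
    show "x \<in> (\<Union>j<m. sym_diff (?F j) (B j))"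
    proof (rule ccontr)
      assume "\<not> ?thesis"
      then have *: "x \<in> B j \<longleftrightarrow> p x = j" if "j < m" for j
        using that x by blast
      have xM: "x \<in> space M" and neq: "p x \<noteq> q x" using x by simp_all
      have px: "p x < m" using p(2)[OF xM] .
      have "x \<in> B' (p x)"
        using *[OF px] xM by (simp add: B'_def)
      moreover have "x \<notin> B' i" if "i < p x" for i
        using *[of i] that px Suc by (simp add: B'_def)
      ultimately have "q x = p x" using q[OF xM] by blast
      with neq show False by simp
    qed
  qed
  then have "measure M {x \<in> space M. p x \<noteq> q x} \<le> measure M (\<Union>j<m. sym_diff (?F j) (B j))"
    using F Bs by (intro finite_measure_mono) auto
  also have "\<dots> \<le> (\<Sum>j<m. measure M (sym_diff (?F j) (B j)))"
    using F Bs by (intro measure_subadditive_finite) auto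
  also have "\<dots> \<le> (\<Sum>j<m. e / Suc m)"
    using B(2) by (intro sum_mono less_imp_le)
  also have "\<dots> < e"
    using e by (simp add: field_simps)
  finally show ?thesis using that[of q] qm qA by blast
qed

lemma finite_measure_add:
  assumes P: "finite_measure P" and Q: "finite_measure Q" and sets: "sets Q = sets P"
  obtains R where "finite_measure R" "sets R = sets P"
    "\<And>A. A \<in> sets P \<Longrightarrow> measure R A = measure P A + measure Q A"
proof -
  interpret P: finite_measure P by fact
  interpret Q: finite_measure Q by fact
  define R where "R = measure_of (space P) (sets P) (\<lambda>A. emeasure P A + emeasure Q A)"
  have setsR: "sets R = sets P" and spaceR: "space R = space P"
    by (simp_all add: R_def)
  have em: "emeasure R A = emeasure P A + emeasure Q A" if A: "A \<in> sets P" for A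
  proof (rule emeasure_measure_of[OF R_def])
    show "countably_additive (sets R) (\<lambda>A. emeasure P A + emeasure Q A)"
    proof (rule countably_additiveI)
      fix A :: "nat \<Rightarrow> 'a set"
      assume "range A \<subseteq> sets R" "disjoint_family A"
      then show "(\<Sum>i. emeasure P (A i) + emeasure Q (A i)) = emeasure P (\<Union> (range A)) + emeasure Q (\<Union> (range A))"
        by (simp add: suminf_add[symmetric] suminf_emeasure setsR sets)
    qed
  qed (use A in \<open>auto simp: positive_def setsR sets.sets_into_space[THEN subsetD]\<close>)
  show ?thesis
  proof
    show "finite_measure R"
      by (rule finite_measureI) (simp add: spaceR em ennreal_add_eq_top P.emeasure_eq_measure Q.emeasure_eq_measure)
    show "sets R = sets P" by fact
    show "measure R A = measure P A + measure Q A" if "A \<in> sets P" for A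
      using em[OF that]
      by (simp add: measure_def[of R] P.emeasure_eq_measure Q.emeasure_eq_measure flip: ennreal_plus)
  qed
qed

text \<open>In a product of finite sets each factor is discrete, so every condition on one coordinate is clopen.\<close>

lemma clopen_subsets_coordinate:
  fixes S :: "'i \<Rightarrow> 'b::t1_space set"
  assumes "\<And>i. finite (S i)"
  shows "{y \<in> Pi UNIV S. y i \<in> F} \<in> clopen_subsets (Pi UNIV S)"
proof -
  have cl: "closed {y \<in> Pi UNIV S. y i \<in> H}" for H
  proof -
    have *: "closed {y. y j \<in> T}" if "finite T" for j and T :: "'b set"
      using closed_vimage[OF finite_imp_closed[OF that] continuous_on_product_coordinates[of j]]
      by (simp add: vimage_def)
    have "{y \<in> Pi UNIV S. y i \<in> H} = (\<Inter>j. {y. y j \<in> S j}) \<inter> {y. y i \<in> S i \<inter> H}" by auto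
    also have "closed \<dots>" using assms by (intro closed_Int closed_INT ballI *) auto
    finally show ?thesis .
  qed
  have "Pi UNIV S - {y \<in> Pi UNIV S. y i \<in> F} = {y \<in> Pi UNIV S. y i \<in> - F}" by auto
  then show ?thesis using cl[of F] cl[of "- F"] by (auto simp: clopen_subsets_def)
qed

section \<open>Coordinates of finite graphons and of quotients\<close>

text \<open>The coordinates of a finite graphon, extended by their natural value \<open>0\<close> instead of being restricted
to \<open>coord_index k\<close>. All finite graphons thus live in one Polish function space, independent of \<open>k\<close>.\<close>

definition total_coords ::
    "nat measure \<times> (nat \<times> nat) measure \<Rightarrow> nat + nat \<times> nat \<Rightarrow> real" where
  "total_coords = (\<lambda>(\<rho>, \<nu>). case_sum (\<lambda>i. measure \<rho> {i}) (\<lambda>p. measure \<nu> {p}))"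

lemma sets_fin_space_square: "sets (fin_space k \<Otimes>\<^sub>M fin_space k) = Pow ({1..k} \<times> {1..k})"
  by (rule sets_pair_countable) auto

lemma sets_fin_graphon:
  assumes "(\<rho>, \<nu>) \<in> fin_graphons k"
  shows "sets \<rho> = Pow {1..k}" "sets \<nu> = Pow ({1..k} \<times> {1..k})"
  using assms unfolding fin_graphons_def square_graphon_def sets_fin_space_square by simp_all

lemma finite_coord_index: "finite (coord_index k)"
  by (simp add: coord_index_def)

lemma total_coords_outside:
  assumes "G \<in> fin_graphons k" "s \<notin> coord_index k"
  shows "total_coords G s = 0"
proof -
  obtain \<rho> \<nu> where [simp]: "G = (\<rho>, \<nu>)" by fastforce
  show ?thesis
    using assms sets_fin_graphon[of \<rho> \<nu> k]
    by (cases s) (auto simp: total_coords_def coord_index_def intro!: measure_notin_sets)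
qed

text \<open>Restriction to \<open>coord_index k\<close> and extension by \<open>0\<close> are continuous maps that translate the two
kinds of coordinates into each other, so they induce the same topology.\<close>

lemma fin_graphon_topology_eq:
  "fin_graphon_topology k = pullback_topology (fin_graphons k) total_coords euclidean"
proof -
  let ?I = "coord_index k" and ?r = "\<lambda>v. restrict v (coord_index k)"
  let ?h = "\<lambda>(u :: nat + nat \<times> nat \<Rightarrow> real) s. if s \<in> coord_index k then u s else 0"
  have gc: "graphon_coords k G = ?r (total_coords G)" for G
    by (auto simp: graphon_coords_def total_coords_def split: prod.splits)
  have h: "?h (graphon_coords k G) = total_coords G" if "G \<in> fin_graphons k" for G
    using total_coords_outside[OF that] by (auto simp: gc)
  have gt: "graphon_coords k G \<in> topspace (powertop_real ?I)" for G
    by (simp add: gc)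
  have cr: "continuous_map euclidean (powertop_real ?I) ?r"
    by (auto simp: continuous_map_componentwise)
  have ch: "continuous_map (powertop_real ?I) euclidean ?h"
    unfolding euclidean_product_topology[symmetric] continuous_map_componentwise_UNIV
  proof
    fix s
    show "continuous_map (powertop_real ?I) euclidean (\<lambda>u. ?h u s)"
      using continuous_map_product_projection[of s ?I "\<lambda>_. euclidean"] by (cases "s \<in> ?I") simp_all
  qed
  show ?thesis
    unfolding fin_graphon_topology_def topology_eq openin_pullback_topology
  proof (intro allI iffI; elim exE conjE)
    fix S U assume U: "openin (powertop_real ?I) U" and S: "S = graphon_coords k -` U \<inter> fin_graphons k"
    show "\<exists>V. openin euclidean V \<and> S = total_coords -` V \<inter> fin_graphons k"
      using openin_continuous_map_preimage[OF cr U]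
      by (intro exI[of _ "{v. ?r v \<in> U}"]) (auto simp: S gc)
  next
    fix S V assume V: "openin euclidean V" and S: "S = total_coords -` V \<inter> fin_graphons k"
    show "\<exists>U. openin (powertop_real ?I) U \<and> S = graphon_coords k -` U \<inter> fin_graphons k"
      using openin_continuous_map_preimage[OF ch V]
      by (intro exI[of _ "{u \<in> topspace (powertop_real ?I). ?h u \<in> V}"])
         (auto simp: S h gt simp del: topspace_product_topology)
  qed
qed

lemma inj_on_total_coords: "inj_on total_coords (fin_graphons k)"
proof (rule inj_onI)
  fix G H assume GH: "G \<in> fin_graphons k" "H \<in> fin_graphons k" and eq: "total_coords G = total_coords H"
  obtain \<rho> \<nu> \<rho>' \<nu>' where [simp]: "G = (\<rho>, \<nu>)" "H = (\<rho>', \<nu>')" by fastforce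
  interpret \<rho>: prob_space \<rho> using GH by (auto simp: fin_graphons_def square_graphon_def)
  interpret \<rho>': prob_space \<rho>' using GH by (auto simp: fin_graphons_def square_graphon_def)
  interpret \<nu>: finite_measure \<nu> using GH by (auto simp: fin_graphons_def square_graphon_def)
  interpret \<nu>': finite_measure \<nu>' using GH by (auto simp: fin_graphons_def square_graphon_def)
  have "measure \<rho> {i} = measure \<rho>' {i}" for i
    using fun_cong[OF eq, of "Inl i"] by (simp add: total_coords_def)
  then have "\<rho> = \<rho>'"
    using GH by (intro measure_eqI_finite[where A="{1..k}"])
      (auto simp: sets_fin_graphon \<rho>.emeasure_eq_measure \<rho>'.emeasure_eq_measure)
  moreover have "measure \<nu> {p} = measure \<nu>' {p}" for p
    using fun_cong[OF eq, of "Inr p"] by (simp add: total_coords_def)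
  then have "\<nu> = \<nu>'"
    using GH by (intro measure_eqI_finite[where A="{1..k} \<times> {1..k}"])
      (auto simp: sets_fin_graphon \<nu>.emeasure_eq_measure \<nu>'.emeasure_eq_measure)
  ultimately show "G = H" by simp
qed

definition stochastic_vectors :: "nat \<Rightarrow> (nat \<Rightarrow> real) set" where
  "stochastic_vectors k = {t. (\<forall>i. 0 \<le> t i) \<and> (\<forall>i. i \<notin> {1..k} \<longrightarrow> t i = 0) \<and> sum t {1..k} = 1}"

text \<open>A Markov kernel to \<open>[k]\<close> is the same thing as a measurable map into the probability simplex, that
is, a \<open>k\<close>-tuple of measurable functions with values in \<open>[0,1]\<close> and sum \<open>1\<close>.\<close>

definition fractional_partitions :: "nat \<Rightarrow> 'a measure \<Rightarrow> ('a \<Rightarrow> nat \<Rightarrow> real) set" where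
  "fractional_partitions k M =
     {f. (\<forall>i. (\<lambda>x. f x i) \<in> borel_measurable M) \<and> (\<forall>x\<in>space M. f x \<in> stochastic_vectors k)}"

text \<open>The coordinates of the pushforward of \<open>(\<pi>, \<mu>)\<close> along the kernel that corresponds to \<open>f\<close>.\<close>

definition quotient_coords ::
    "'a measure \<Rightarrow> ('a \<times> 'a) measure \<Rightarrow> ('a \<Rightarrow> nat \<Rightarrow> real) \<Rightarrow> nat + nat \<times> nat \<Rightarrow> real" where
  "quotient_coords \<pi> \<mu> f = case_sum (\<lambda>i. \<integral>x. f x i \<partial>\<pi>) (\<lambda>(i, j). \<integral>z. f (fst z) i * f (snd z) j \<partial>\<mu>)"

lemma stochastic_vector_le_1:
  assumes "t \<in> stochastic_vectors k"
  shows "t i \<le> 1"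
proof (cases "i \<in> {1..k}")
  case True
  then have "t i \<le> sum t {1..k}"
    using assms by (intro member_le_sum) (auto simp: stochastic_vectors_def)
  then show ?thesis using assms by (simp add: stochastic_vectors_def)
qed (use assms in \<open>auto simp: stochastic_vectors_def\<close>)

lemma fractional_partitionD:
  assumes "f \<in> fractional_partitions k M"
  shows "\<And>i. (\<lambda>x. f x i) \<in> borel_measurable M"
    "\<And>x i. x \<in> space M \<Longrightarrow> 0 \<le> f x i" "\<And>x i. x \<in> space M \<Longrightarrow> f x i \<le> 1"
    "\<And>x i. x \<in> space M \<Longrightarrow> i \<notin> {1..k} \<Longrightarrow> f x i = 0"
    "\<And>x. x \<in> space M \<Longrightarrow> sum (f x) {1..k} = 1"
  using assms stochastic_vector_le_1[of _ k]
  by (auto simp: fractional_partitions_def stochastic_vectors_def)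

lemma measure_pushforward:
  assumes "space \<pi> \<noteq> {}" "sets \<pi> = sets M" "\<kappa> \<in> M \<rightarrow>\<^sub>M prob_algebra N" "B \<in> sets N"
  shows "measure (\<pi> \<bind> \<kappa>) B = (\<integral>x. measure (\<kappa> x) B \<partial>\<pi>)"
proof -
  have \<kappa>: "prob_space (\<kappa> x)" if "x \<in> space \<pi>" for x
    using that assms(2,3) sets_eq_imp_space_eq[OF assms(2)] by (auto simp: markov_kernel_iff)
  have "(\<lambda>x. emeasure (\<kappa> x) B) \<in> borel_measurable \<pi>"
    using assms by (auto simp: markov_kernel_iff cong: measurable_cong_sets)
  then have meas: "(\<lambda>x. measure (\<kappa> x) B) \<in> borel_measurable \<pi>"
    unfolding measure_def by measurable
  have "emeasure (\<pi> \<bind> \<kappa>) B = (\<integral>\<^sup>+x. ennreal (measure (\<kappa> x) B) \<partial>\<pi>)"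
    unfolding emeasure_pushforward[OF assms]
    using \<kappa> by (intro nn_integral_cong) (simp add: finite_measure.emeasure_eq_measure prob_space_def)
  then show ?thesis
    using meas by (subst integral_eq_nn_integral) (auto simp: measure_def)
qed

context
  fixes M \<pi> :: "'a measure" and \<mu> :: "('a \<times> 'a) measure"
  assumes graphon: "square_graphon M \<pi> \<mu>"
begin

lemma graphon_spaces:
  "space \<pi> = space M" "space \<mu> = space M \<times> space M" "space M \<noteq> {}"
  using graphon sets_eq_imp_space_eq[of \<pi> M] sets_eq_imp_space_eq[of \<mu> "M \<Otimes>\<^sub>M M"]
    prob_space.not_empty[of \<pi>]
  by (auto simp: square_graphon_def space_pair_measure)

lemma graphon_sets: "sets \<pi> = sets M" "sets \<mu> = sets (M \<Otimes>\<^sub>M M)"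
  using graphon by (auto simp: square_graphon_def)

lemma graphon_measurable:
  "measurable \<pi> N = measurable M N" "measurable \<mu> N = measurable (M \<Otimes>\<^sub>M M) N"
  using graphon_sets by (auto cong: measurable_cong_sets)

lemma total_coords_pushforward:
  assumes \<kappa>: "\<kappa> \<in> M \<rightarrow>\<^sub>M prob_algebra (fin_space k)"
  shows "(\<pi> \<bind> \<kappa>, \<mu> \<bind> kernel_square \<kappa>) \<in> fin_graphons k"
    and "total_coords (\<pi> \<bind> \<kappa>, \<mu> \<bind> kernel_square \<kappa>) = quotient_coords \<pi> \<mu> (\<lambda>x i. measure (\<kappa> x) {i})"
proof -
  interpret \<pi>: prob_space \<pi> using graphon by (simp add: square_graphon_def)
  interpret \<mu>: finite_measure \<mu> using graphon by (simp add: square_graphon_def)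
  note \<kappa>2 = kernel_square_measurable[OF \<kappa>]
  have ne: "space \<pi> \<noteq> {}" "space \<mu> \<noteq> {}" using graphon_spaces by auto
  have K: "prob_space (\<kappa> x)" "sets (\<kappa> x) = Pow {1..k}" if "x \<in> space M" for x
    using markov_kernel_iff[THEN iffD1, OF \<kappa>, THEN conjunct1] that by auto
  have K2: "prob_space (kernel_square \<kappa> x)" "sets (kernel_square \<kappa> x) = sets (fin_space k \<Otimes>\<^sub>M fin_space k)"
    if "x \<in> space M \<times> space M" for x
    using markov_kernel_iff[THEN iffD1, OF \<kappa>2, THEN conjunct1] that by (auto simp: space_pair_measure)
  have s1: "sets (\<pi> \<bind> \<kappa>) = sets (fin_space k)"
    using ne by (intro sets_bind) (simp_all add: graphon_spaces K)
  have s2: "sets (\<mu> \<bind> kernel_square \<kappa>) = sets (fin_space k \<Otimes>\<^sub>M fin_space k)"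
    using ne by (intro sets_bind) (simp_all add: graphon_spaces K2)
  have "prob_space (\<pi> \<bind> \<kappa>)"
    using measurable_prob_algebraD[OF \<kappa>]
    by (intro \<pi>.prob_space_bind[where S="fin_space k"] AE_I2) (simp_all add: K graphon_spaces graphon_measurable)
  moreover have "finite_measure (\<mu> \<bind> kernel_square \<kappa>)"
  proof
    have "emeasure (\<mu> \<bind> kernel_square \<kappa>) (space (fin_space k \<Otimes>\<^sub>M fin_space k))
        = (\<integral>\<^sup>+x. emeasure (kernel_square \<kappa> x) (space (fin_space k \<Otimes>\<^sub>M fin_space k)) \<partial>\<mu>)"
      using ne \<kappa>2 by (intro emeasure_pushforward) (auto simp: graphon_sets)
    also have "\<dots> = (\<integral>\<^sup>+x. 1 \<partial>\<mu>)"
      using sets_eq_imp_space_eq[OF K2(2)] prob_space.emeasure_space_1[OF K2(1)]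
      by (intro nn_integral_cong) (simp add: graphon_spaces)
    finally show "emeasure (\<mu> \<bind> kernel_square \<kappa>) (space (\<mu> \<bind> kernel_square \<kappa>)) \<noteq> \<infinity>"
      using sets_eq_imp_space_eq[OF s2] by simp
  qed
  ultimately show in_fin: "(\<pi> \<bind> \<kappa>, \<mu> \<bind> kernel_square \<kappa>) \<in> fin_graphons k"
    using s1 s2 unfolding fin_graphons_def square_graphon_def by blast
  show "total_coords (\<pi> \<bind> \<kappa>, \<mu> \<bind> kernel_square \<kappa>) = quotient_coords \<pi> \<mu> (\<lambda>x i. measure (\<kappa> x) {i})"
  proof
    fix s
    have zero: "measure (\<kappa> x) {i} = 0" if "x \<in> space M" "i \<notin> {1..k}" for x i
      using that K(2)[of x] by (intro measure_notin_sets) auto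
    show "total_coords (\<pi> \<bind> \<kappa>, \<mu> \<bind> kernel_square \<kappa>) s = quotient_coords \<pi> \<mu> (\<lambda>x i. measure (\<kappa> x) {i}) s"
    proof (cases "s \<in> coord_index k")
      case False
      have "quotient_coords \<pi> \<mu> (\<lambda>x i. measure (\<kappa> x) {i}) s = 0"
      proof (cases s)
        case (Inl i)
        then have "i \<notin> {1..k}" using False by (auto simp: coord_index_def)
        then have "(\<integral>x. measure (\<kappa> x) {i} \<partial>\<pi>) = (\<integral>x. 0 \<partial>\<pi>)"
          using zero by (intro Bochner_Integration.integral_cong) (simp_all add: graphon_spaces)
        then show ?thesis by (simp add: Inl quotient_coords_def)
      next
        case (Inr p)
        then have "fst p \<notin> {1..k} \<or> snd p \<notin> {1..k}"
          using False by (cases p) (auto simp: coord_index_def)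
        then have "(\<integral>z. measure (\<kappa> (fst z)) {fst p} * measure (\<kappa> (snd z)) {snd p} \<partial>\<mu>) = (\<integral>z. 0 \<partial>\<mu>)"
          using zero by (intro Bochner_Integration.integral_cong) (auto simp: graphon_spaces)
        then show ?thesis by (simp add: Inr quotient_coords_def split_beta)
      qed
      then show ?thesis using total_coords_outside[OF in_fin False] by simp
    next
      case True
      show ?thesis
      proof (cases s)
        case (Inl i)
        then have "i \<in> {1..k}" using True by (auto simp: coord_index_def)
        then show ?thesis
          using measure_pushforward[OF ne(1) graphon_sets(1) \<kappa>, of "{i}"]
          by (simp add: Inl total_coords_def quotient_coords_def)
      next
        case (Inr p)
        obtain i j where p: "p = (i, j)" by fastforce
        have ij: "i \<in> {1..k}" "j \<in> {1..k}" using True Inr p by (auto simp: coord_index_def)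
        have "measure (kernel_square \<kappa> z) {(i, j)} = measure (\<kappa> (fst z)) {i} * measure (\<kappa> (snd z)) {j}"
          if z: "z \<in> space \<mu>" for z
        proof -
          obtain x y where xy: "z = (x, y)" "x \<in> space M" "y \<in> space M"
            using z graphon_spaces by auto
          interpret Y: prob_space "\<kappa> y" using K xy by auto
          interpret X: prob_space "\<kappa> x" using K xy by auto
          have "emeasure (\<kappa> x \<Otimes>\<^sub>M \<kappa> y) ({i} \<times> {j}) = emeasure (\<kappa> x) {i} * emeasure (\<kappa> y) {j}"
            using ij by (intro Y.emeasure_pair_measure_Times) (simp_all add: K xy)
          then have "emeasure (kernel_square \<kappa> z) {(i, j)} = emeasure (\<kappa> x) {i} * emeasure (\<kappa> y) {j}"
            by (simp add: kernel_square_def xy)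
          then show ?thesis
            using xy by (simp add: measure_def enn2real_mult)
        qed
        then have "(\<integral>z. measure (kernel_square \<kappa> z) {(i, j)} \<partial>\<mu>) =
            (\<integral>z. measure (\<kappa> (fst z)) {i} * measure (\<kappa> (snd z)) {j} \<partial>\<mu>)"
          by (intro Bochner_Integration.integral_cong refl)
        moreover have "measure (\<mu> \<bind> kernel_square \<kappa>) {(i, j)} = (\<integral>z. measure (kernel_square \<kappa> z) {(i, j)} \<partial>\<mu>)"
          using ij by (intro measure_pushforward[OF ne(2) graphon_sets(2) \<kappa>2]) (simp add: sets_fin_space_square)
        ultimately show ?thesis
          by (simp add: Inr p total_coords_def quotient_coords_def)
      qed
    qed
  qed
qed

text \<open>This reduces everything about morphisms to finite graphons to integrals of real functions: a kernel
\<open>\<kappa>\<close> yields the tuple \<open>\<lambda>x i. \<kappa>(x, {i})\<close>, and a tuple \<open>f\<close> yields the kernel of point measures with weights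
\<open>f x i\<close>.\<close>

lemma total_coords_down_set:
  "total_coords ` down_set k M \<pi> \<mu> = quotient_coords \<pi> \<mu> ` fractional_partitions k M"
proof (intro equalityI subsetI)
  fix v assume "v \<in> total_coords ` down_set k M \<pi> \<mu>"
  then obtain \<kappa> where \<kappa>: "\<kappa> \<in> M \<rightarrow>\<^sub>M prob_algebra (fin_space k)"
    and v: "v = total_coords (\<pi> \<bind> \<kappa>, \<mu> \<bind> kernel_square \<kappa>)"
    unfolding down_set_def graphon_morphism_def by blast
  let ?f = "\<lambda>x i. measure (\<kappa> x) {i}"
  have K: "prob_space (\<kappa> x)" "sets (\<kappa> x) = Pow {1..k}" if "x \<in> space M" for x
    using markov_kernel_iff[THEN iffD1, OF \<kappa>, THEN conjunct1] that by auto
  have "?f \<in> fractional_partitions k M"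
    unfolding fractional_partitions_def
  proof (intro CollectI conjI allI ballI)
    fix i
    have zero: "measure (\<kappa> x) {i} = 0" if "x \<in> space M" "i \<notin> {1..k}" for x
      using that K(2)[of x] by (intro measure_notin_sets) auto
    show "(\<lambda>x. ?f x i) \<in> borel_measurable M"
    proof (cases "i \<in> {1..k}")
      case True
      then have "(\<lambda>x. emeasure (\<kappa> x) {i}) \<in> borel_measurable M"
        using \<kappa> by (auto simp: markov_kernel_iff)
      then show ?thesis unfolding measure_def by measurable
    next
      case False
      then show ?thesis using zero by (subst measurable_cong[where g="\<lambda>_. 0"]) auto
    qed
  next
    fix x assume x: "x \<in> space M"
    interpret X: prob_space "\<kappa> x" using K x by auto
    have sp: "space (\<kappa> x) = {1..k}"
      using K(2)[OF x] sets_eq_imp_space_eq[of "\<kappa> x" "fin_space k"] by simp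
    have "(\<Sum>i\<in>{1..k}. ?f x i) = measure (\<kappa> x) {1..k}"
      using K(2)[OF x] by (subst X.finite_measure_eq_sum_singleton) auto
    also have "\<dots> = 1" using X.prob_space sp by simp
    finally show "?f x \<in> stochastic_vectors k"
      using K(2)[OF x] by (auto simp: stochastic_vectors_def intro!: measure_notin_sets)
  qed
  then show "v \<in> quotient_coords \<pi> \<mu> ` fractional_partitions k M"
    using v total_coords_pushforward(2)[OF \<kappa>] by auto
next
  fix v assume "v \<in> quotient_coords \<pi> \<mu> ` fractional_partitions k M"
  then obtain f where f: "f \<in> fractional_partitions k M" and v: "v = quotient_coords \<pi> \<mu> f"
    by auto
  note f' = fractional_partitionD[OF f]
  define \<kappa> where "\<kappa> = (\<lambda>x. point_measure {1..k} (\<lambda>i. ennreal (f x i)))"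
  have \<kappa>_em: "emeasure (\<kappa> x) B = (\<Sum>i\<in>B. ennreal (f x i))" if "B \<subseteq> {1..k}" for x B
    using that finite_subset[OF that] unfolding \<kappa>_def by (intro emeasure_point_measure_finite2) auto
  have "\<kappa> \<in> M \<rightarrow>\<^sub>M prob_algebra (fin_space k)"
    unfolding markov_kernel_iff
  proof (intro conjI ballI)
    fix x assume x: "x \<in> space M"
    have "(\<Sum>i\<in>{1..k}. ennreal (f x i)) = ennreal (\<Sum>i\<in>{1..k}. f x i)"
      using f'(2)[OF x] by simp
    then show "prob_space (\<kappa> x)"
      using \<kappa>_em[of "{1..k}" x] f'(5)[OF x]
      by (intro prob_spaceI) (simp add: \<kappa>_def space_point_measure)
    show "sets (\<kappa> x) = sets (fin_space k)"
      by (simp add: \<kappa>_def sets_point_measure)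
  next
    fix B assume "B \<in> sets (fin_space k)"
    then have "B \<subseteq> {1..k}" by simp
    then show "(\<lambda>x. emeasure (\<kappa> x) B) \<in> borel_measurable M"
      using f'(1) by (simp add: \<kappa>_em)
  qed
  note \<kappa> = total_coords_pushforward[OF this] this
  have m: "measure (\<kappa> x) {i} = f x i" if x: "x \<in> space M" for x i
  proof (cases "i \<in> {1..k}")
    case True
    then show ?thesis using \<kappa>_em[of "{i}" x] f'(2)[OF x] by (simp add: measure_def)
  next
    case False
    then show ?thesis using f'(4)[OF x]
      by (subst measure_notin_sets) (auto simp: \<kappa>_def sets_point_measure)
  qed
  have "quotient_coords \<pi> \<mu> (\<lambda>x i. measure (\<kappa> x) {i}) = v"
    unfolding v quotient_coords_def
    by (intro arg_cong2[where f=case_sum] ext)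
       (auto simp: m graphon_spaces split: prod.splits intro!: Bochner_Integration.integral_cong)
  then show "v \<in> total_coords ` down_set k M \<pi> \<mu>"
    using \<kappa> by (intro image_eqI[where x="(\<pi> \<bind> \<kappa>, \<mu> \<bind> kernel_square \<kappa>)"])
      (auto simp: down_set_def graphon_morphism_def)
qed

end

context
  fixes M \<pi> :: "'a measure" and \<mu> :: "('a \<times> 'a) measure"
  assumes graphon: "square_graphon M \<pi> \<mu>"
begin

interpretation \<pi>: prob_space \<pi> using graphon by (simp add: square_graphon_def)
interpretation \<mu>: finite_measure \<mu> using graphon by (simp add: square_graphon_def)

lemma measurable_graphon_fst_snd:
  assumes "h \<in> M \<rightarrow>\<^sub>M N"
  shows "(\<lambda>z. h (fst z)) \<in> \<mu> \<rightarrow>\<^sub>M N" "(\<lambda>z. h (snd z)) \<in> \<mu> \<rightarrow>\<^sub>M N"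
  using assms by (simp_all add: graphon_measurable[OF graphon])

lemma rectangle_in_sets:
  assumes "A \<in> sets M" "B \<in> sets M"
  shows "A \<times> B \<in> sets \<mu>"
  using assms by (simp add: graphon_sets[OF graphon])

text \<open>The products in the edge coordinates are compared by
\<open>f x i * f y j - g x i * g y j = (f x i - g x i) * f y j + g x i * (f y j - g y j)\<close>, where the remaining factors
lie in \<open>[0,1]\<close>. The indicator allows \<open>f\<close> and \<open>g\<close> to differ arbitrarily on a set \<open>A\<close>, at the price of its
\<open>\<pi>\<close>-measure and its measure under both marginals of \<open>\<mu>\<close>.\<close>

lemma quotient_coords_close:
  assumes f: "f \<in> fractional_partitions k M" and g: "g \<in> fractional_partitions k M"
    and A: "A \<in> sets M" and e: "0 \<le> e"
    and close: "\<And>x i. x \<in> space M \<Longrightarrow> \<bar>f x i - g x i\<bar> \<le> e + indicator A x"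
  shows "\<bar>quotient_coords \<pi> \<mu> f s - quotient_coords \<pi> \<mu> g s\<bar> \<le>
    (1 + 2 * measure \<mu> (space \<mu>)) * e +
    (measure \<pi> A + measure \<mu> (A \<times> space M) + measure \<mu> (space M \<times> A))"
proof (cases s)
  note sp = graphon_spaces[OF graphon]
  case (Inl i)
  have int: "integrable \<pi> (\<lambda>x. h x i)" if h: "h \<in> fractional_partitions k M" for h
    using fractional_partitionD[OF h]
    by (intro \<pi>.integrable_const_bound[where B=1] AE_I2)
       (simp_all add: sp graphon_measurable[OF graphon])
  have A': "A \<in> sets \<pi>" using A by (simp add: graphon_sets[OF graphon])
  have "\<bar>(\<integral>x. f x i \<partial>\<pi>) - (\<integral>x. g x i \<partial>\<pi>)\<bar> = \<bar>\<integral>x. f x i - g x i \<partial>\<pi>\<bar>"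
    using int[OF f] int[OF g] by simp
  also have "\<dots> \<le> (\<integral>x. \<bar>f x i - g x i\<bar> \<partial>\<pi>)"
    by (rule integral_abs_bound)
  also have "\<dots> \<le> (\<integral>x. e + indicator A x \<partial>\<pi>)"
    using int[OF f] int[OF g] A' close
    by (intro integral_mono) (simp_all add: sp \<pi>.emeasure_eq_measure)
  also have "\<dots> = e + measure \<pi> A"
    using A' \<pi>.prob_space sets.Int_space_eq2[OF A'] by (simp add: \<pi>.emeasure_eq_measure)
  also have "\<dots> \<le> (1 + 2 * measure \<mu> (space \<mu>)) * e +
    (measure \<pi> A + measure \<mu> (A \<times> space M) + measure \<mu> (space M \<times> A))"
    using e by (simp add: algebra_simps)
  finally show ?thesis by (simp add: Inl quotient_coords_def)
next
  note f' = fractional_partitionD[OF f] and g' = fractional_partitionD[OF g]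
  note sp = graphon_spaces[OF graphon]
  case (Inr p)
  obtain i j where p: "p = (i, j)" by fastforce
  have int: "integrable \<mu> (\<lambda>z. h (fst z) i * h (snd z) j)" if h: "h \<in> fractional_partitions k M" for h
    using fractional_partitionD[OF h] measurable_graphon_fst_snd[OF fractional_partitionD(1)[OF h]]
    by (intro \<mu>.integrable_const_bound[where B=1] AE_I2 borel_measurable_times)
       (auto simp: sp abs_mult intro!: mult_le_one)
  have A': "A \<times> space M \<in> sets \<mu>" "space M \<times> A \<in> sets \<mu>"
    using A by (auto intro: rectangle_in_sets)
  have bound: "\<bar>f (fst z) i * f (snd z) j - g (fst z) i * g (snd z) j\<bar>
      \<le> 2 * e + indicator (A \<times> space M) z + indicator (space M \<times> A) z" if z: "z \<in> space \<mu>" for z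
  proof -
    obtain x y where xy: "z = (x, y)" "x \<in> space M" "y \<in> space M" using z sp by auto
    have "f x i * f y j - g x i * g y j = (f x i - g x i) * f y j + g x i * (f y j - g y j)"
      by (simp add: algebra_simps)
    also have "\<bar>\<dots>\<bar> \<le> \<bar>f x i - g x i\<bar> * f y j + g x i * \<bar>f y j - g y j\<bar>"
      using f'(2)[OF xy(3)] g'(2)[OF xy(2)]
      by (intro order_trans[OF abs_triangle_ineq]) (simp add: abs_mult)
    also have "\<dots> \<le> \<bar>f x i - g x i\<bar> * 1 + 1 * \<bar>f y j - g y j\<bar>"
      using f'(3)[OF xy(3)] g'(3)[OF xy(2)]
      by (intro add_mono mult_left_mono mult_right_mono) simp_all
    also have "\<dots> \<le> (e + indicator A x) + (e + indicator A y)"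
      using add_mono[OF close[OF xy(2), of i] close[OF xy(3), of j]] by simp
    finally show ?thesis
      using xy by (simp add: indicator_def)
  qed
  have "\<bar>(\<integral>z. f (fst z) i * f (snd z) j \<partial>\<mu>) - (\<integral>z. g (fst z) i * g (snd z) j \<partial>\<mu>)\<bar> =
      \<bar>\<integral>z. f (fst z) i * f (snd z) j - g (fst z) i * g (snd z) j \<partial>\<mu>\<bar>"
    using int[OF f] int[OF g] by simp
  also have "\<dots> \<le> (\<integral>z. \<bar>f (fst z) i * f (snd z) j - g (fst z) i * g (snd z) j\<bar> \<partial>\<mu>)"
    by (rule integral_abs_bound)
  also have "\<dots> \<le> (\<integral>z. 2 * e + indicator (A \<times> space M) z + indicator (space M \<times> A) z \<partial>\<mu>)"
    using int[OF f] int[OF g] A' bound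
    by (intro integral_mono) (simp_all add: \<mu>.emeasure_eq_measure)
  also have "\<dots> = 2 * measure \<mu> (space \<mu>) * e + measure \<mu> (A \<times> space M) + measure \<mu> (space M \<times> A)"
    using A' sets.Int_space_eq2[OF A'(1)] sets.Int_space_eq2[OF A'(2)]
    by (simp add: \<mu>.emeasure_eq_measure)
  also have "\<dots> \<le> (1 + 2 * measure \<mu> (space \<mu>)) * e +
    (measure \<pi> A + measure \<mu> (A \<times> space M) + measure \<mu> (space M \<times> A))"
    using e by (simp add: algebra_simps)
  finally show ?thesis by (simp add: Inr p quotient_coords_def)
qed

text \<open>For a fractional partition that factors through a finite partition into the sets \<open>L a\<close>, the integrals
become finite sums that see \<open>\<mu>\<close> only on rectangles.\<close>

lemma quotient_coords_step:
  fixes p :: "'a \<Rightarrow> nat"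
  assumes p: "p \<in> M \<rightarrow>\<^sub>M count_space UNIV" and pm: "\<And>x. x \<in> space M \<Longrightarrow> p x < m"
  defines "L j \<equiv> p -` {j} \<inter> space M"
  shows "quotient_coords \<pi> \<mu> (\<lambda>x. t (p x)) = case_sum
    (\<lambda>i. \<Sum>a<m. t a i * measure \<pi> (L a))
    (\<lambda>(i, j). \<Sum>a<m. \<Sum>b<m. t a i * t b j * measure \<mu> (L a \<times> L b))"
proof
  fix s
  note sp = graphon_spaces[OF graphon]
  have L: "L a \<in> sets M" for a
    unfolding L_def by (rule measurable_sets[OF p]) simp
  have L\<pi>: "L a \<in> sets \<pi>" for a using L by (simp add: graphon_sets[OF graphon])
  have L\<mu>: "L a \<times> L b \<in> sets \<mu>" for a b using L by (simp add: rectangle_in_sets)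
  show "quotient_coords \<pi> \<mu> (\<lambda>x. t (p x)) s = case_sum
    (\<lambda>i. \<Sum>a<m. t a i * measure \<pi> (L a))
    (\<lambda>(i, j). \<Sum>a<m. \<Sum>b<m. t a i * t b j * measure \<mu> (L a \<times> L b)) s"
  proof (cases s)
    case (Inl i)
    have "(\<integral>x. t (p x) i \<partial>\<pi>) = (\<integral>x. (\<Sum>a<m. t a i * indicator (L a) x) \<partial>\<pi>)"
    proof (intro Bochner_Integration.integral_cong refl)
      fix x assume "x \<in> space \<pi>"
      then have "t a i * indicator (L a) x = (if a = p x then t (p x) i else 0)" for a
        by (auto simp: L_def sp)
      then have "(\<Sum>a<m. t a i * indicator (L a) x) = (\<Sum>a<m. if a = p x then t (p x) i else 0)"
        by simp
      also have "\<dots> = t (p x) i"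
        using pm[of x] \<open>x \<in> space \<pi>\<close> by (subst sum.delta) (simp_all add: sp)
      finally show "t (p x) i = (\<Sum>a<m. t a i * indicator (L a) x)" ..
    qed
    also have "\<dots> = (\<Sum>a<m. t a i * measure \<pi> (L a))"
      using L\<pi> sets.Int_space_eq2[OF L\<pi>]
      by (subst Bochner_Integration.integral_sum) (simp_all add: \<pi>.emeasure_eq_measure)
    finally show ?thesis by (simp add: Inl quotient_coords_def)
  next
    case (Inr q)
    obtain i j where q: "q = (i, j)" by fastforce
    have "(\<integral>z. t (p (fst z)) i * t (p (snd z)) j \<partial>\<mu>) =
        (\<integral>z. (\<Sum>a<m. \<Sum>b<m. t a i * t b j * indicator (L a \<times> L b) z) \<partial>\<mu>)"
    proof (intro Bochner_Integration.integral_cong refl)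
      fix z assume "z \<in> space \<mu>"
      then obtain x y where xy: "z = (x, y)" "x \<in> space M" "y \<in> space M" using sp by auto
      then have "t a i * t b j * indicator (L a \<times> L b) z =
          (if a = p x then if b = p y then t (p x) i * t (p y) j else 0 else 0)" for a b
        by (auto simp: L_def indicator_def)
      then have "(\<Sum>a<m. \<Sum>b<m. t a i * t b j * indicator (L a \<times> L b) z) =
          (\<Sum>a<m. if a = p x then \<Sum>b<m. (if b = p y then t (p x) i * t (p y) j else 0) else 0)"
        by (intro sum.cong) auto
      then show "t (p (fst z)) i * t (p (snd z)) j = (\<Sum>a<m. \<Sum>b<m. t a i * t b j * indicator (L a \<times> L b) z)"
        using pm xy by simp
    qed
    also have "\<dots> = (\<Sum>a<m. \<Sum>b<m. t a i * t b j * measure \<mu> (L a \<times> L b))"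
    proof (subst Bochner_Integration.integral_sum)
      have int: "integrable \<mu> (\<lambda>z. t a i * t b j * indicator (L a \<times> L b) z)" for a b
        using L\<mu> by (simp add: \<mu>.emeasure_eq_measure)
      then show "integrable \<mu> (\<lambda>z. \<Sum>b<m. t a i * t b j * indicator (L a \<times> L b) z)" for a
        by (intro Bochner_Integration.integrable_sum)
      show "(\<Sum>a<m. \<integral>z. (\<Sum>b<m. t a i * t b j * indicator (L a \<times> L b) z) \<partial>\<mu>) =
          (\<Sum>a<m. \<Sum>b<m. t a i * t b j * measure \<mu> (L a \<times> L b))"
        using L\<mu> sets.Int_space_eq2[OF L\<mu>] int
        by (intro sum.cong refl, subst Bochner_Integration.integral_sum)
           (simp_all add: \<mu>.emeasure_eq_measure)
    qed
    finally show ?thesis by (simp add: Inr q quotient_coords_def)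
  qed
qed

end

section \<open>Step functions\<close>

lemma step_fractional_partition:
  fixes p :: "'a \<Rightarrow> nat"
  assumes "p \<in> M \<rightarrow>\<^sub>M count_space UNIV" "\<And>x. x \<in> space M \<Longrightarrow> p x < m"
    and "\<And>j. j < m \<Longrightarrow> t j \<in> stochastic_vectors k"
  shows "(\<lambda>x. t (p x)) \<in> fractional_partitions k M"
  using assms measurable_compose[OF assms(1), of _ borel]
  by (auto simp: fractional_partitions_def)

lemma compact_stochastic_vectors: "compact (stochastic_vectors k)"
proof -
  have *: "closed {t :: nat \<Rightarrow> real. \<forall>i. i \<notin> {1..k} \<longrightarrow> t i = 0}"
    by (intro closed_Collect_all closed_Collect_imp open_Collect_const closed_Collect_eq
        continuous_on_product_coordinates continuous_on_const)
  have **: "closed {t :: nat \<Rightarrow> real. sum t {1..k} = 1}"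
    by (intro closed_Collect_eq continuous_on_sum continuous_on_product_coordinates continuous_on_const)
  have "stochastic_vectors k = Pi UNIV (\<lambda>_. {0..1}) \<inter>
      ({t. \<forall>i. i \<notin> {1..k} \<longrightarrow> t i = 0} \<inter> {t. sum t {1..k} = 1})"
    using stochastic_vector_le_1[of _ k] by (auto simp: stochastic_vectors_def)
  also have "compact \<dots>"
    by (intro compact_Int_closed compact_Pi_UNIV closed_Int * **) simp
  finally show ?thesis .
qed

text \<open>A finite net in the compact simplex. The case \<open>k = 0\<close> is excluded because the simplex is then empty.
The bound holds at all indices since vectors in the simplex agree outside \<open>{1..k}\<close>.\<close>

lemma stochastic_vectors_net:
  assumes "1 \<le> k" "0 < e"
  obtains m t where "0 < (m::nat)" "\<And>j. j < m \<Longrightarrow> t j \<in> stochastic_vectors k"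
    "\<And>v. v \<in> stochastic_vectors k \<Longrightarrow> \<exists>j<m. \<forall>i. \<bar>v i - t j i\<bar> < e"
proof -
  let ?U = "\<lambda>t :: nat \<Rightarrow> real. {v. \<forall>i\<in>{1..k}. \<bar>v i - t i\<bar> < e}"
  have "?U t = (\<Inter>i\<in>{1..k}. {v. \<bar>v i - t i\<bar> < e})" for t by auto
  moreover have "open {v :: nat \<Rightarrow> real. \<bar>v i - t i\<bar> < e}" for i t
    by (intro open_Collect_less continuous_intros continuous_on_product_coordinates)
  ultimately have "open (?U t)" for t by (auto intro!: open_INT)
  then obtain T where T: "T \<subseteq> stochastic_vectors k" "finite T"
    "stochastic_vectors k \<subseteq> (\<Union>t\<in>T. ?U t)"
    by (rule compactE_image[OF compact_stochastic_vectors, where C="stochastic_vectors k" and f="?U"])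
      (use \<open>0 < e\<close> in auto)
  obtain t where t: "bij_betw t {..<card T} T"
    using ex_bij_betw_nat_finite[OF T(2)] by (auto simp: atLeast0LessThan)
  have net: "\<exists>j<card T. \<forall>i. \<bar>v i - t j i\<bar> < e" if v: "v \<in> stochastic_vectors k" for v
  proof -
    obtain w where w: "w \<in> T" "\<And>i. i \<in> {1..k} \<Longrightarrow> \<bar>v i - w i\<bar> < e"
      using T(3) v by auto
    then obtain j where j: "j < card T" "w = t j"
      using bij_betw_imp_surj_on[OF t] by auto
    have "\<bar>v i - w i\<bar> < e" for i
    proof (cases "i \<in> {1..k}")
      case False
      moreover have "w \<in> stochastic_vectors k" using T w by auto
      ultimately have "v i = 0" "w i = 0" using v by (auto simp: stochastic_vectors_def)
      then show ?thesis using \<open>0 < e\<close> by simp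
    qed (use w in auto)
    with j show ?thesis by blast
  qed
  \<comment> \<open>A vertex of the simplex shows that the net is nonempty.\<close>
  have "(\<lambda>i. if i = 1 then 1 else 0) \<in> stochastic_vectors k"
    using \<open>1 \<le> k\<close> by (auto simp: stochastic_vectors_def)
  from net[OF this] have "0 < card T" by auto
  moreover have "t j \<in> stochastic_vectors k" if "j < card T" for j
    using bij_betw_imp_surj_on[OF t] T(1) that by auto
  ultimately show ?thesis using net that[of "card T" t] by blast
qed

text \<open>Rounding to the first close point of a finite net is a measurable operation.\<close>

lemma fractional_partition_step_approx:
  assumes f: "f \<in> fractional_partitions k M"
    and net: "\<And>v. v \<in> stochastic_vectors k \<Longrightarrow> \<exists>j<m. \<forall>i. \<bar>v i - t j i\<bar> < e"
  obtains p where "p \<in> M \<rightarrow>\<^sub>M count_space (UNIV :: nat set)" "\<And>x. x \<in> space M \<Longrightarrow> p x < m"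
    "\<And>x i. x \<in> space M \<Longrightarrow> \<bar>f x i - t (p x) i\<bar> < e"
proof -
  note [measurable] = fractional_partitionD(1)[OF f]
  define p where "p x = (LEAST j. \<forall>i. \<bar>f x i - t j i\<bar> < e)" for x
  have "p \<in> M \<rightarrow>\<^sub>M count_space UNIV"
    unfolding p_def by measurable
  moreover have "p x < m \<and> (\<forall>i. \<bar>f x i - t (p x) i\<bar> < e)" if x: "x \<in> space M" for x
  proof -
    obtain j where j: "j < m" "\<forall>i. \<bar>f x i - t j i\<bar> < e"
      using net[of "f x"] f x by (auto simp: fractional_partitions_def)
    have "p x \<le> j" unfolding p_def by (rule Least_le[where P="\<lambda>j. \<forall>i. \<bar>f x i - t j i\<bar> < e", OF j(2)])
    moreover have "\<forall>i. \<bar>f x i - t (p x) i\<bar> < e"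
      unfolding p_def by (rule LeastI[where P="\<lambda>j. \<forall>i. \<bar>f x i - t j i\<bar> < e", OF j(2)])
    ultimately show ?thesis using j(1) by simp
  qed
  ultimately show ?thesis using that by blast
qed

text \<open>The topology of uniform convergence is finer than that of pointwise convergence.\<close>

lemma open_contains_sup_ball:
  fixes U :: "('i \<Rightarrow> real) set"
  assumes "open U" "x \<in> U"
  obtains e where "0 < e" "\<And>y. (\<And>i. \<bar>y i - x i\<bar> < e) \<Longrightarrow> y \<in> U"
proof -
  have "openin (product_topology (\<lambda>_. euclidean) UNIV) U"
    using assms by (simp add: euclidean_product_topology)
  from product_topology_open_contains_basis[OF this assms(2)]
  obtain X where X': "x \<in> (\<Pi>\<^sub>E i\<in>UNIV. X i)" "\<forall>i. openin euclidean (X i)"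
    "finite {i. X i \<noteq> topspace euclidean}" "(\<Pi>\<^sub>E i\<in>UNIV. X i) \<subseteq> U"
    by (elim exE conjE)
  then have X: "x \<in> Pi UNIV X" "\<And>i. open (X i)" "finite {i. X i \<noteq> UNIV}" "Pi UNIV X \<subseteq> U"
    by (simp_all add: PiE_UNIV_domain)
  let ?J = "{i. X i \<noteq> UNIV}"
  have "\<exists>e>0. \<forall>y. \<bar>y - x i\<bar> < e \<longrightarrow> y \<in> X i" for i
    using X(2)[of i, unfolded open_dist dist_real_def, rule_format, of "x i"] X(1) by (simp add: Pi_iff)
  then obtain d where d: "\<And>i. 0 < d i" "\<And>i y. \<bar>y - x i\<bar> < d i \<Longrightarrow> y \<in> X i"
    by metis
  let ?e = "Min (insert 1 (d ` ?J))"
  show ?thesis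
  proof
    show "0 < ?e" using X(3) d(1) by simp
    fix y assume y: "\<And>i. \<bar>y i - x i\<bar> < ?e"
    have "y i \<in> X i" for i
    proof (cases "i \<in> ?J")
      case True
      then have "?e \<le> d i" using X(3) by (intro Min_le) auto
      then show ?thesis using y[of i] by (intro d(2)) linarith
    qed simp
    then show "y \<in> U" using X(4) by auto
  qed
qed

text \<open>First \<open>f\<close> is rounded to a finite net, uniformly; then the level sets are replaced by clopen ones up to a
set that is small for \<open>\<pi>\<close> and for both marginals of \<open>\<mu>\<close>. The marginals have to be included since \<open>\<mu>\<close> need
not be related to \<open>\<pi>\<close>.\<close>

lemma approximate_by_clopen_step:
  fixes N :: "'b::t2_space measure"
  assumes graphon: "square_graphon N \<pi> \<mu>"
    and N: "sets N = sigma_sets (space N) (clopen_subsets (space N))" and closed: "closed (space N)"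
    and f: "f \<in> fractional_partitions k N" and k: "1 \<le> k" and e: "0 < e"
  obtains m t q where "\<And>j. j < m \<Longrightarrow> t j \<in> stochastic_vectors k"
    "\<And>y. y \<in> space N \<Longrightarrow> q y < (m :: nat)" "\<And>j. q -` {j} \<inter> space N \<in> clopen_subsets (space N)"
    "q \<in> N \<rightarrow>\<^sub>M count_space UNIV"
    "\<And>s. \<bar>quotient_coords \<pi> \<mu> f s - quotient_coords \<pi> \<mu> (\<lambda>y. t (q y)) s\<bar> < e"
proof -
  interpret \<pi>: prob_space \<pi> using graphon by (simp add: square_graphon_def)
  interpret \<mu>: finite_measure \<mu> using graphon by (simp add: square_graphon_def)
  note se = graphon_sets[OF graphon] and sp = graphon_spaces[OF graphon]
  define c where "c = 1 + 2 * measure \<mu> (space \<mu>)"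
  have c: "0 < c" by (simp add: c_def add_pos_nonneg)
  define e' where "e' = e / (2 * c)"
  have e': "0 < e'" "c * e' = e / 2" using e c by (simp_all add: e'_def)
  obtain m t where mt: "0 < (m::nat)" "\<And>j. j < m \<Longrightarrow> t j \<in> stochastic_vectors k"
    "\<And>v. v \<in> stochastic_vectors k \<Longrightarrow> \<exists>j<m. \<forall>i. \<bar>v i - t j i\<bar> < e'"
    using stochastic_vectors_net[OF k e'(1)] by blast
  obtain p where p: "p \<in> N \<rightarrow>\<^sub>M count_space (UNIV :: nat set)" "\<And>x. x \<in> space N \<Longrightarrow> p x < m"
    "\<And>x i. x \<in> space N \<Longrightarrow> \<bar>f x i - t (p x) i\<bar> < e'"
    using fractional_partition_step_approx[OF f mt(3)] by blast
  have m1: "fst \<in> \<mu> \<rightarrow>\<^sub>M N" "snd \<in> \<mu> \<rightarrow>\<^sub>M N"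
    by (simp_all add: graphon_measurable[OF graphon])
  \<comment> \<open>The sum of \<open>\<pi>\<close> and the two marginals of \<open>\<mu>\<close> controls all three error terms at once.\<close>
  obtain R where R: "finite_measure R" "sets R = sets (distr \<mu> N fst)"
    "\<And>A. A \<in> sets (distr \<mu> N fst) \<Longrightarrow> measure R A = measure (distr \<mu> N fst) A + measure (distr \<mu> N snd) A"
    using finite_measure_add[OF \<mu>.finite_measure_distr[OF m1(1)] \<mu>.finite_measure_distr[OF m1(2)]] by auto
  obtain \<Lambda> where \<Lambda>: "finite_measure \<Lambda>" "sets \<Lambda> = sets \<pi>"
    "\<And>A. A \<in> sets \<pi> \<Longrightarrow> measure \<Lambda> A = measure \<pi> A + measure R A"
    using finite_measure_add[OF \<pi>.finite_measure_axioms R(1)] R(2) se by auto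
  have sets\<Lambda>: "sets \<Lambda> = sets N" using \<Lambda>(2) se by simp
  have space\<Lambda>: "space \<Lambda> = space N" using sets_eq_imp_space_eq[OF sets\<Lambda>] .
  have \<Lambda>m: "measure \<Lambda> A = measure \<pi> A + measure \<mu> (A \<times> space N) + measure \<mu> (space N \<times> A)"
    if A: "A \<in> sets N" for A
  proof -
    have "fst -` A \<inter> space \<mu> = A \<times> space N" "snd -` A \<inter> space \<mu> = space N \<times> A"
      using sets.sets_into_space[OF A] by (auto simp: sp)
    then show ?thesis
      using A m1 by (simp add: \<Lambda>(3) R(3) se measure_distr)
  qed
  interpret \<Lambda>: finite_measure \<Lambda> by fact
  have "p \<in> \<Lambda> \<rightarrow>\<^sub>M count_space UNIV"
    using p(1) sets\<Lambda> by (simp cong: measurable_cong_sets)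
  moreover have "algebra (space \<Lambda>) (clopen_subsets (space N))"
    unfolding space\<Lambda> by (rule algebra_clopen_subsets[OF closed])
  moreover have "sets \<Lambda> = sigma_sets (space \<Lambda>) (clopen_subsets (space N))"
    unfolding space\<Lambda> sets\<Lambda> by (rule N)
  moreover have "p x < m" if "x \<in> space \<Lambda>" for x
    using p(2) that by (simp add: space\<Lambda>)
  moreover have "0 < e / 2" using e by simp
  ultimately obtain q where q: "\<And>x. x \<in> space N \<Longrightarrow> q x < m"
    "\<And>j. q -` {j} \<inter> space N \<in> clopen_subsets (space N)"
    "measure \<Lambda> {x \<in> space N. p x \<noteq> q x} < e / 2"
    using \<Lambda>.approximate_step_by_algebra[of "clopen_subsets (space N)" p m "e / 2"] mt(1)
    unfolding space\<Lambda> by blast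
  have qj: "q -` {j} \<inter> space N \<in> sets N" for j
    unfolding N using q(2) by (rule sigma_sets.Basic)
  have qm: "q \<in> N \<rightarrow>\<^sub>M count_space UNIV"
    using qj by (subst measurable_count_space_eq2_countable) simp_all
  let ?A = "{x \<in> space N. p x \<noteq> q x}"
  have pj: "p -` {j} \<inter> space N \<in> sets N" for j
    by (rule measurable_sets[OF p(1)]) simp
  have "?A = space N - (\<Union>j. (p -` {j} \<inter> space N) \<inter> (q -` {j} \<inter> space N))" by auto
  also have "\<dots> \<in> sets N" using pj qj by (intro sets.Diff sets.top sets.countable_UN) blast
  finally have A: "?A \<in> sets N" .
  have tq: "(\<lambda>y. t (q y)) \<in> fractional_partitions k N"
    using qm q(1) mt(2) by (rule step_fractional_partition)
  have close: "\<bar>f x i - t (q x) i\<bar> \<le> e' + indicator ?A x" if x: "x \<in> space N" for x i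
  proof (cases "x \<in> ?A")
    case True
    have "0 \<le> f x i" "f x i \<le> 1" "0 \<le> t (q x) i" "t (q x) i \<le> 1"
      using fractional_partitionD(2,3)[OF f x] fractional_partitionD(2,3)[OF tq x] by auto
    then show ?thesis using True e'(1) by (simp add: abs_le_iff)
  next
    case False
    then have "p x = q x" using x by simp
    with p(3)[OF x, of i] False show ?thesis by simp
  qed
  have "\<bar>quotient_coords \<pi> \<mu> f s - quotient_coords \<pi> \<mu> (\<lambda>y. t (q y)) s\<bar> < e" for s
    using quotient_coords_close[OF graphon f tq A less_imp_le[OF e'(1)] close, of s] q(3) e'(2) \<Lambda>m[OF A]
    unfolding c_def by simp
  with mt(2) q(1,2) qm show ?thesis using that[of m t q] by blast
qed

lemma open_sup_box:
  assumes "finite I"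
  shows "open {v :: 'i \<Rightarrow> real. \<forall>s\<in>I. \<bar>v s - d s\<bar> < e}"
proof -
  have "{v. \<forall>s\<in>I. \<bar>v s - d s\<bar> < e} = (\<Inter>s\<in>I. {v. \<bar>v s - d s\<bar> < e})" by auto
  moreover have "open {v :: 'i \<Rightarrow> real. \<bar>v s - d s\<bar> < e}" for s
    by (intro open_Collect_less continuous_intros continuous_on_product_coordinates)
  ultimately show ?thesis using assms by (auto intro!: open_INT)
qed

section \<open>Limit graphons\<close>

lemma clopen_subsets_Times:
  assumes "closed \<Omega>" "A \<in> clopen_subsets \<Omega>" "B \<in> clopen_subsets \<Omega>"
  shows "A \<times> B \<in> clopen_subsets (\<Omega> \<times> \<Omega>)"
proof -
  have "\<Omega> \<times> \<Omega> - A \<times> B = (\<Omega> - A) \<times> \<Omega> \<union> \<Omega> \<times> (\<Omega> - B)" by auto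
  with assms show ?thesis
    by (auto simp: clopen_subsets_def intro!: closed_Times closed_Un)
qed

text \<open>The graphons are pushed forward along measurable maps into one compact set \<open>\<Omega>\<close>. Along a suitable
filter the measures of all clopen sets converge, the limits are finitely additive, and so they extend
to measures. The edge measure is built on the clopen subsets of \<open>\<Omega> \<times> \<Omega>\<close>, which generate at least
the product \<open>\<sigma>\<close>-algebra, and then restricted to the latter.\<close>

lemma limit_graphon_exists:
  fixes \<Omega> :: "'b::{second_countable_topology, t2_space} set"
    and M :: "nat \<Rightarrow> 'a measure" and \<Phi> :: "nat \<Rightarrow> 'a \<Rightarrow> 'b"
  assumes graphons: "\<And>n. square_graphon (M n) (\<pi> n) (\<mu> n)"
    and mass: "\<forall>\<^sub>F n in sequentially. measure (\<mu> n) (space (\<mu> n)) \<le> C"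
    and \<Omega>: "compact \<Omega>"
    and \<Phi>: "\<And>n. \<Phi> n \<in> borel_measurable (M n)" "\<And>n x. x \<in> space (M n) \<Longrightarrow> \<Phi> n x \<in> \<Omega>"
  obtains G and N \<pi>' :: "'b measure" and \<mu>' where "G \<le> sequentially" "G \<noteq> bot" "square_graphon N \<pi>' \<mu>'"
    "space N = \<Omega>" "sets N = sigma_sets \<Omega> (clopen_subsets \<Omega>)"
    "\<And>n. \<Phi> n \<in> M n \<rightarrow>\<^sub>M N"
    "\<And>A. A \<in> clopen_subsets \<Omega> \<Longrightarrow>
      ((\<lambda>n. measure (\<pi> n) (\<Phi> n -` A \<inter> space (M n))) \<longlongrightarrow> measure \<pi>' A) G"
    "\<And>A B. A \<in> clopen_subsets \<Omega> \<Longrightarrow> B \<in> clopen_subsets \<Omega> \<Longrightarrow>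
      ((\<lambda>n. measure (\<mu> n) ((\<Phi> n -` A \<inter> space (M n)) \<times> (\<Phi> n -` B \<inter> space (M n)))) \<longlongrightarrow> measure \<mu>' (A \<times> B)) G"
proof -
  note sp = graphon_spaces[OF graphons] and se = graphon_sets[OF graphons]
  let ?\<Psi> = "\<lambda>n. map_prod (\<Phi> n) (\<Phi> n)"
  \<comment> \<open>Both families of values go into one function, so that a single filter handles them together.\<close>
  let ?g = "\<lambda>n. case_sum (\<lambda>A. measure (\<pi> n) (\<Phi> n -` A \<inter> space (\<pi> n))) (\<lambda>B. measure (\<mu> n) (?\<Psi> n -` B \<inter> space (\<mu> n)))"
  have prob: "prob_space (\<pi> n)" and fin: "finite_measure (\<pi> n)" "finite_measure (\<mu> n)" for n
    using graphons[of n] by (auto simp: square_graphon_def prob_space_def)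
  have \<Omega>2: "compact (\<Omega> \<times> \<Omega>)" using \<Omega> by (intro compact_Times)
  have "\<forall>\<^sub>F n in sequentially. \<forall>i. 0 \<le> ?g n i \<and> ?g n i \<le> max 1 C"
    using mass
  proof eventually_elim
    case (elim n)
    show ?case
    proof
      fix i
      show "0 \<le> ?g n i \<and> ?g n i \<le> max 1 C"
        using prob_space.prob_le_1[OF prob[of n]] order_trans[OF finite_measure.bounded_measure[OF fin(2)] elim]
        by (cases i) (auto simp: max.coboundedI1 max.coboundedI2)
    qed
  qed
  then obtain G l where G: "G \<le> sequentially" "G \<noteq> bot" and l: "\<And>i. ((\<lambda>n. ?g n i) \<longlongrightarrow> l i) G"
    by (rule bounded_family_limit_filter[OF trivial_limit_sequentially]) auto
  have l1: "((\<lambda>n. measure (\<pi> n) (\<Phi> n -` A \<inter> space (\<pi> n))) \<longlongrightarrow> l (Inl A)) G" for A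
    using l[of "Inl A"] by simp
  have l2: "((\<lambda>n. measure (\<mu> n) (?\<Psi> n -` B \<inter> space (\<mu> n))) \<longlongrightarrow> l (Inr B)) G" for B
    using l[of "Inr B"] by simp
  have m1: "\<Phi> n -` A \<inter> space (\<pi> n) \<in> sets (\<pi> n)" if "A \<in> clopen_subsets \<Omega>" for n A
    using measurable_sets[OF \<Phi>(1)[of n], of A] that by (auto simp: clopen_subsets_def sp se)
  have "?\<Psi> n \<in> borel_measurable (\<mu> n)" for n
    using \<Phi>(1)[of n] by (simp add: borel_prod[symmetric] map_prod_def split_beta' graphon_measurable[OF graphons])
  then have m2: "?\<Psi> n -` A \<inter> space (\<mu> n) \<in> sets (\<mu> n)" if "A \<in> clopen_subsets (\<Omega> \<times> \<Omega>)" for n A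
    by (rule measurable_sets) (use that in \<open>auto simp: clopen_subsets_def\<close>)
  have "l (Inl (A \<union> B)) = l (Inl A) + l (Inl B)"
    if "A \<in> clopen_subsets \<Omega>" "B \<in> clopen_subsets \<Omega>" "A \<inter> B = {}" for A B
  proof (rule tendsto_unique[OF G(2) l1])
    have "measure (\<pi> n) (\<Phi> n -` (A \<union> B) \<inter> space (\<pi> n)) =
        measure (\<pi> n) (\<Phi> n -` A \<inter> space (\<pi> n)) + measure (\<pi> n) (\<Phi> n -` B \<inter> space (\<pi> n))" for n
      using that m1 unfolding vimage_Un Int_Un_distrib2
      by (intro finite_measure.finite_measure_Union fin) auto
    then show "((\<lambda>n. measure (\<pi> n) (\<Phi> n -` (A \<union> B) \<inter> space (\<pi> n))) \<longlongrightarrow> l (Inl A) + l (Inl B)) G"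
      using tendsto_add[OF l1 l1] by simp
  qed
  moreover have "0 \<le> l (Inl A)" for A
    by (rule tendsto_lowerbound[OF l1 _ G(2)]) simp
  ultimately obtain P where P: "finite_measure P" "sets P = sets (sigma \<Omega> (clopen_subsets \<Omega>))"
    "\<And>A. A \<in> clopen_subsets \<Omega> \<Longrightarrow> measure P A = l (Inl A)"
    using clopen_subsets_extension[OF \<Omega>, of "\<lambda>A. l (Inl A)"] by blast
  have "l (Inr (A \<union> B)) = l (Inr A) + l (Inr B)"
    if "A \<in> clopen_subsets (\<Omega> \<times> \<Omega>)" "B \<in> clopen_subsets (\<Omega> \<times> \<Omega>)" "A \<inter> B = {}" for A B
  proof (rule tendsto_unique[OF G(2) l2])
    have "measure (\<mu> n) (?\<Psi> n -` (A \<union> B) \<inter> space (\<mu> n)) =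
        measure (\<mu> n) (?\<Psi> n -` A \<inter> space (\<mu> n)) + measure (\<mu> n) (?\<Psi> n -` B \<inter> space (\<mu> n))" for n
      using that m2 unfolding vimage_Un Int_Un_distrib2
      by (intro finite_measure.finite_measure_Union fin) auto
    then show "((\<lambda>n. measure (\<mu> n) (?\<Psi> n -` (A \<union> B) \<inter> space (\<mu> n))) \<longlongrightarrow> l (Inr A) + l (Inr B)) G"
      using tendsto_add[OF l2 l2] by simp
  qed
  moreover have "0 \<le> l (Inr A)" for A
    by (rule tendsto_lowerbound[OF l2 _ G(2)]) simp
  ultimately obtain Q where Q: "finite_measure Q" "sets Q = sets (sigma (\<Omega> \<times> \<Omega>) (clopen_subsets (\<Omega> \<times> \<Omega>)))"
    "\<And>A. A \<in> clopen_subsets (\<Omega> \<times> \<Omega>) \<Longrightarrow> measure Q A = l (Inr A)"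
    using clopen_subsets_extension[OF \<Omega>2, of "\<lambda>A. l (Inr A)"] by blast
  define N where "N = sigma \<Omega> (clopen_subsets \<Omega>)"
  have cl: "clopen_subsets \<Omega> \<subseteq> Pow \<Omega>" "clopen_subsets (\<Omega> \<times> \<Omega>) \<subseteq> Pow (\<Omega> \<times> \<Omega>)"
    by (auto simp: clopen_subsets_def)
  have N: "space N = \<Omega>" "sets N = sigma_sets \<Omega> (clopen_subsets \<Omega>)"
    using cl by (simp_all add: N_def)
  have \<Omega>cl: "\<Omega> \<in> clopen_subsets \<Omega>" using \<Omega> by (simp add: clopen_subsets_def compact_imp_closed)
  have spQ: "space Q = \<Omega> \<times> \<Omega>"
    using sets_eq_imp_space_eq[OF Q(2)] cl by simp
  have measN: "h \<in> L \<rightarrow>\<^sub>M N"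
    if "h \<in> space L \<rightarrow> \<Omega>" "\<And>A. A \<in> clopen_subsets \<Omega> \<Longrightarrow> h -` A \<inter> space L \<in> sets L" for h and L :: "('b \<times> 'b) measure"
    unfolding N_def using that cl by (intro measurable_measure_of) auto
  have \<Phi>N: "\<Phi> n \<in> M n \<rightarrow>\<^sub>M N" for n
    unfolding N_def using m1[of _ n] \<Phi>(2) cl by (intro measurable_measure_of) (auto simp: sp se)
  have "fst \<in> Q \<rightarrow>\<^sub>M N"
  proof (rule measN)
    fix A assume A: "A \<in> clopen_subsets \<Omega>"
    then have "fst -` A \<inter> space Q = A \<times> \<Omega>" by (auto simp: spQ clopen_subsets_def)
    then show "fst -` A \<inter> space Q \<in> sets Q"
      using clopen_subsets_Times[OF compact_imp_closed[OF \<Omega>] A \<Omega>cl] cl Q(2) by simp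
  qed (auto simp: spQ)
  moreover have "snd \<in> Q \<rightarrow>\<^sub>M N"
  proof (rule measN)
    fix A assume A: "A \<in> clopen_subsets \<Omega>"
    then have "snd -` A \<inter> space Q = \<Omega> \<times> A" by (auto simp: spQ clopen_subsets_def)
    then show "snd -` A \<inter> space Q \<in> sets Q"
      using clopen_subsets_Times[OF compact_imp_closed[OF \<Omega>] \<Omega>cl A] cl Q(2) by simp
  qed (auto simp: spQ)
  ultimately have idQ: "(\<lambda>z. z) \<in> Q \<rightarrow>\<^sub>M N \<Otimes>\<^sub>M N"
    by (intro measurable_pair) (simp_all add: comp_def)
  define \<mu>' where "\<mu>' = distr Q (N \<Otimes>\<^sub>M N) (\<lambda>z. z)"
  have spP: "space P = \<Omega>" using sets_eq_imp_space_eq[OF P(2)] cl by simp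
  have "l (Inl \<Omega>) = 1"
  proof (rule tendsto_unique[OF G(2) l1])
    have "\<Phi> n -` \<Omega> \<inter> space (\<pi> n) = space (\<pi> n)" for n
      using \<Phi>(2) by (auto simp: sp)
    then show "((\<lambda>n. measure (\<pi> n) (\<Phi> n -` \<Omega> \<inter> space (\<pi> n))) \<longlongrightarrow> 1) G"
      using prob_space.prob_space[OF prob] by simp
  qed
  then have "prob_space P"
    using P(3)[OF \<Omega>cl] by (intro prob_spaceI) (simp add: spP finite_measure.emeasure_eq_measure[OF P(1)])
  then have graphon: "square_graphon N P \<mu>'"
    using P(2) finite_measure.finite_measure_distr[OF Q(1) idQ]
    by (simp add: square_graphon_def \<mu>'_def N_def)
  show ?thesis
  proof (rule that[OF G graphon N \<Phi>N])
    show "((\<lambda>n. measure (\<pi> n) (\<Phi> n -` A \<inter> space (M n))) \<longlongrightarrow> measure P A) G"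
      if "A \<in> clopen_subsets \<Omega>" for A
      using l1[of A] P(3)[OF that] by (simp add: sp)
  next
    fix A B assume AB: "A \<in> clopen_subsets \<Omega>" "B \<in> clopen_subsets \<Omega>"
    have cAB: "A \<times> B \<in> clopen_subsets (\<Omega> \<times> \<Omega>)"
      using clopen_subsets_Times[OF compact_imp_closed[OF \<Omega>] AB] .
    have "A \<times> B \<inter> space Q = A \<times> B" using cAB by (auto simp: spQ clopen_subsets_def)
    moreover have "A \<times> B \<in> sets (N \<Otimes>\<^sub>M N)" using AB by (intro pair_measureI) (simp_all add: N)
    ultimately have "measure \<mu>' (A \<times> B) = measure Q (A \<times> B)"
      unfolding \<mu>'_def by (subst measure_distr[OF idQ]) simp_all
    moreover have "?\<Psi> n -` (A \<times> B) \<inter> space (\<mu> n) = (\<Phi> n -` A \<inter> space (M n)) \<times> (\<Phi> n -` B \<inter> space (M n))" for n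
      by (auto simp: sp)
    ultimately show "((\<lambda>n. measure (\<mu> n) ((\<Phi> n -` A \<inter> space (M n)) \<times> (\<Phi> n -` B \<inter> space (M n)))) \<longlongrightarrow> measure \<mu>' (A \<times> B)) G"
      using l2[of "A \<times> B"] Q(3)[OF cAB] by simp
  qed
qed

text \<open>The coordinates of a step function with levels in \<open>\<A>\<close> are linear expressions in measures of members
of \<open>\<A>\<close> and rectangles of such, so they pass to the limit.\<close>

lemma quotient_coords_step_tendsto:
  fixes q :: "'b \<Rightarrow> nat"
  assumes graphons: "\<And>n. square_graphon (M n) (\<pi> n) (\<mu> n)" and graphon: "square_graphon N \<pi>' \<mu>'"
    and \<Phi>: "\<And>n. \<Phi> n \<in> M n \<rightarrow>\<^sub>M N"
    and conv1: "\<And>A. A \<in> \<A> \<Longrightarrow> ((\<lambda>n. measure (\<pi> n) (\<Phi> n -` A \<inter> space (M n))) \<longlongrightarrow> measure \<pi>' A) G"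
    and conv2: "\<And>A B. A \<in> \<A> \<Longrightarrow> B \<in> \<A> \<Longrightarrow>
      ((\<lambda>n. measure (\<mu> n) ((\<Phi> n -` A \<inter> space (M n)) \<times> (\<Phi> n -` B \<inter> space (M n)))) \<longlongrightarrow> measure \<mu>' (A \<times> B)) G"
    and q: "q \<in> N \<rightarrow>\<^sub>M count_space UNIV" "\<And>y. y \<in> space N \<Longrightarrow> q y < m" "\<And>j. q -` {j} \<inter> space N \<in> \<A>"
  shows "((\<lambda>n. quotient_coords (\<pi> n) (\<mu> n) (\<lambda>x. t (q (\<Phi> n x)))) \<longlongrightarrow> quotient_coords \<pi>' \<mu>' (\<lambda>y. t (q y))) G"
proof -
  let ?L = "\<lambda>j. q -` {j} \<inter> space N"
  have L: "(\<lambda>x. q (\<Phi> n x)) -` {j} \<inter> space (M n) = \<Phi> n -` ?L j \<inter> space (M n)" for n j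
    using measurable_space[OF \<Phi>[of n]] by auto
  have eq: "quotient_coords (\<pi> n) (\<mu> n) (\<lambda>x. t (q (\<Phi> n x))) = case_sum
    (\<lambda>i. \<Sum>a<m. t a i * measure (\<pi> n) (\<Phi> n -` ?L a \<inter> space (M n)))
    (\<lambda>(i, j). \<Sum>a<m. \<Sum>b<m. t a i * t b j * measure (\<mu> n) ((\<Phi> n -` ?L a \<inter> space (M n)) \<times> (\<Phi> n -` ?L b \<inter> space (M n))))" for n
    unfolding L[symmetric]
    using measurable_space[OF \<Phi>[of n]] q(2)
    by (intro quotient_coords_step[OF graphons] measurable_compose[OF \<Phi> q(1)]) auto
  have eq': "quotient_coords \<pi>' \<mu>' (\<lambda>y. t (q y)) = case_sum
    (\<lambda>i. \<Sum>a<m. t a i * measure \<pi>' (?L a))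
    (\<lambda>(i, j). \<Sum>a<m. \<Sum>b<m. t a i * t b j * measure \<mu>' (?L a \<times> ?L b))"
    using q by (intro quotient_coords_step[OF graphon]) auto
  have "((\<lambda>n. quotient_coords (\<pi> n) (\<mu> n) (\<lambda>x. t (q (\<Phi> n x))) s) \<longlongrightarrow> quotient_coords \<pi>' \<mu>' (\<lambda>y. t (q y)) s) G" for s
  proof (cases s)
    case (Inl i)
    show ?thesis
      unfolding eq eq' Inl sum.case by (intro tendsto_sum tendsto_mult tendsto_const conv1 q(3))
  next
    case (Inr p)
    obtain i j where p: "p = (i, j)" by fastforce
    show ?thesis
      unfolding eq eq' Inr p sum.case prod.case by (intro tendsto_sum tendsto_mult tendsto_const conv2 q(3))
  qed
  then have "limitin (product_topology (\<lambda>_. euclidean) UNIV)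
      (\<lambda>n. quotient_coords (\<pi> n) (\<mu> n) (\<lambda>x. t (q (\<Phi> n x)))) (quotient_coords \<pi>' \<mu>' (\<lambda>y. t (q y))) G"
    by (simp add: limitin_componentwise)
  then show ?thesis by (simp add: euclidean_product_topology)
qed

section \<open>Convergence of shapes\<close>

lemma quotient_coords_outside:
  assumes "square_graphon M \<pi> \<mu>" "f \<in> fractional_partitions k M" "s \<notin> coord_index k"
  shows "quotient_coords \<pi> \<mu> f s = 0"
proof -
  have "quotient_coords \<pi> \<mu> f \<in> total_coords ` down_set k M \<pi> \<mu>"
    using assms(2) by (simp add: total_coords_down_set[OF assms(1)])
  then obtain G where "quotient_coords \<pi> \<mu> f = total_coords G" "G \<in> fin_graphons k"
    by (auto simp: down_set_def)
  then show ?thesis using total_coords_outside assms(3) by simp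
qed

lemma down_set_subset: "down_set k M \<pi> \<mu> \<subseteq> fin_graphons k"
  by (auto simp: down_set_def)

lemma compact_total_coords_image:
  assumes "compactin (fin_graphon_topology k) L"
  shows "compact (total_coords ` L)"
proof -
  have "continuous_map (fin_graphon_topology k) euclidean total_coords"
    unfolding fin_graphon_topology_eq
    using continuous_map_pullback[OF continuous_map_id, of "fin_graphons k" total_coords euclidean]
    by simp
  from image_compactin[OF assms this] show ?thesis by simp
qed

lemma shape_limit_compact:
  assumes lim: "limitin (shape_space k) S L F"
  shows "L \<in> compact_subsets (fin_graphon_topology k)" "L \<subseteq> fin_graphons k"
    "closed (total_coords ` L)"
proof -
  show L: "L \<in> compact_subsets (fin_graphon_topology k)"
    using limitin_topspace[OF lim] by (simp add: topspace_vietoris)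
  then have comp: "compactin (fin_graphon_topology k) L"
    by (simp add: compact_subsets_def)
  show "L \<subseteq> fin_graphons k"
    using compactin_subset_topspace[OF comp] by (simp add: topspace_fin_graphon_topology)
  show "closed (total_coords ` L)"
    using compact_total_coords_image[OF comp] by (rule compact_imp_closed)
qed

lemma closedin_fin_graphon_topology:
  assumes "closed (total_coords ` L)" and L: "L \<subseteq> fin_graphons k"
  shows "closedin (fin_graphon_topology k) L"
proof -
  have "openin (fin_graphon_topology k) (fin_graphons k - L)"
    unfolding fin_graphon_topology_eq openin_pullback_topology
  proof (intro exI conjI)
    show "openin euclidean (- total_coords ` L)"
      using assms(1) by (simp add: open_Compl)
    show "fin_graphons k - L = total_coords -` (- total_coords ` L) \<inter> fin_graphons k"
      using inj_on_image_mem_iff[OF inj_on_total_coords _ L] by auto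
  qed
  then show ?thesis
    using L by (simp add: closedin_def topspace_fin_graphon_topology)
qed

text \<open>The two halves of Vietoris convergence, read off in coordinates: all quotients eventually come close
to the limit set, and every point of the limit set is eventually approached by quotients. Passing from
the closure \<open>shape\<close> to \<open>down_set\<close> is harmless because the test sets are open.\<close>

lemma shape_limit_miss:
  assumes graphons: "\<And>n. square_graphon (M n) (\<pi> n) (\<mu> n)"
    and lim: "limitin (shape_space k) (\<lambda>n. shape k (M n) (\<pi> n) (\<mu> n)) L F"
    and U: "open U" "total_coords ` L \<subseteq> U"
  shows "\<forall>\<^sub>F n in F. \<forall>f\<in>fractional_partitions k (M n). quotient_coords (\<pi> n) (\<mu> n) f \<in> U"
proof -
  let ?T = "fin_graphon_topology k"
  define V where "V = total_coords -` U \<inter> fin_graphons k"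
  have V: "openin ?T V"
    using U(1) by (auto simp: fin_graphon_topology_eq openin_pullback_topology V_def)
  have "L \<in> compact_subsets ?T" "L \<subseteq> fin_graphons k"
    using shape_limit_compact[OF lim] by blast+
  with U(2) have "L \<in> {K \<in> compact_subsets ?T. K \<subseteq> V}" by (auto simp: V_def)
  moreover have "openin (shape_space k) {K \<in> compact_subsets ?T. K \<subseteq> V}"
    unfolding vietoris_def using V by (intro topology_generated_by_Basis) blast
  ultimately have "\<forall>\<^sub>F n in F. shape k (M n) (\<pi> n) (\<mu> n) \<in> {K \<in> compact_subsets ?T. K \<subseteq> V}"
    using lim by (auto simp: limitin_def)
  then show ?thesis
  proof eventually_elim
    case (elim n)
    have "down_set k (M n) (\<pi> n) (\<mu> n) \<subseteq> shape k (M n) (\<pi> n) (\<mu> n)"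
      unfolding shape_def using down_set_subset[of k "M n"]
      by (intro closure_of_subset) (auto simp: topspace_fin_graphon_topology)
    with elim have "total_coords ` down_set k (M n) (\<pi> n) (\<mu> n) \<subseteq> U" by (auto simp: V_def)
    then show ?case by (auto simp: total_coords_down_set[OF graphons])
  qed
qed

lemma shape_limit_hit:
  assumes graphons: "\<And>n. square_graphon (M n) (\<pi> n) (\<mu> n)"
    and lim: "limitin (shape_space k) (\<lambda>n. shape k (M n) (\<pi> n) (\<mu> n)) L F"
    and U: "open U" "d \<in> L" "total_coords d \<in> U"
  shows "\<forall>\<^sub>F n in F. \<exists>f\<in>fractional_partitions k (M n). quotient_coords (\<pi> n) (\<mu> n) f \<in> U"
proof -
  let ?T = "fin_graphon_topology k"
  define V where "V = total_coords -` U \<inter> fin_graphons k"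
  have V: "openin ?T V"
    using U(1) by (auto simp: fin_graphon_topology_eq openin_pullback_topology V_def)
  have "L \<in> compact_subsets ?T" "L \<subseteq> fin_graphons k"
    using shape_limit_compact[OF lim] by blast+
  with U(2,3) have "L \<in> {K \<in> compact_subsets ?T. K \<inter> V \<noteq> {}}" by (auto simp: V_def)
  moreover have "openin (shape_space k) {K \<in> compact_subsets ?T. K \<inter> V \<noteq> {}}"
    unfolding vietoris_def using V by (intro topology_generated_by_Basis) blast
  ultimately have "\<forall>\<^sub>F n in F. shape k (M n) (\<pi> n) (\<mu> n) \<in> {K \<in> compact_subsets ?T. K \<inter> V \<noteq> {}}"
    using lim by (auto simp: limitin_def)
  then show ?thesis
  proof eventually_elim
    case (elim n)
    then obtain x where "x \<in> shape k (M n) (\<pi> n) (\<mu> n)" "x \<in> V" by auto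
    with V obtain y where "y \<in> down_set k (M n) (\<pi> n) (\<mu> n)" "y \<in> V"
      unfolding shape_def in_closure_of by blast
    then have "total_coords y \<in> total_coords ` down_set k (M n) (\<pi> n) (\<mu> n)" "total_coords y \<in> U"
      by (auto simp: V_def)
    then show ?case by (auto simp: total_coords_down_set[OF graphons])
  qed
qed

text \<open>The only kernel to a one-point space preserves the total masses, so these are visible in the
\<open>1\<close>-shape and bounded on the compact limit.\<close>

lemma shape_limit_mass_bounded:
  assumes graphons: "\<And>n. square_graphon (M n) (\<pi> n) (\<mu> n)"
    and lim: "limitin (shape_space 1) (\<lambda>n. shape 1 (M n) (\<pi> n) (\<mu> n)) L F"
  obtains C where "\<forall>\<^sub>F n in F. measure (\<mu> n) (space (\<mu> n)) \<le> C"
proof -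
  let ?s = "Inr (1, 1) :: nat + nat \<times> nat"
  have "compact ((\<lambda>v. v ?s) ` total_coords ` L)"
    by (intro compact_continuous_image compact_total_coords_image[of 1]
        continuous_on_subset[OF continuous_on_product_coordinates])
       (use shape_limit_compact(1)[OF lim] in \<open>auto simp: compact_subsets_def\<close>)
  then have "bounded ((\<lambda>v. v ?s) ` total_coords ` L)"
    by (rule compact_imp_bounded)
  then obtain C where C: "\<And>v. v \<in> total_coords ` L \<Longrightarrow> \<bar>v ?s\<bar> \<le> C"
    unfolding bounded_iff by auto
  have "\<forall>\<^sub>F n in F. \<forall>f\<in>fractional_partitions 1 (M n). quotient_coords (\<pi> n) (\<mu> n) f \<in> {v. v ?s < \<bar>C\<bar> + 1}"
  proof (rule shape_limit_miss[OF graphons lim])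
    show "open {v :: nat + nat \<times> nat \<Rightarrow> real. v ?s < \<bar>C\<bar> + 1}"
      by (intro open_Collect_less continuous_on_product_coordinates continuous_on_const)
    show "total_coords ` L \<subseteq> {v. v ?s < \<bar>C\<bar> + 1}" using C by fastforce
  qed
  then have "\<forall>\<^sub>F n in F. measure (\<mu> n) (space (\<mu> n)) \<le> \<bar>C\<bar> + 1"
  proof eventually_elim
    case (elim n)
    let ?f = "\<lambda>_ i. if i = 1 then 1 else 0 :: real"
    have "?f \<in> fractional_partitions 1 (M n)"
      by (auto simp: fractional_partitions_def stochastic_vectors_def)
    with elim have "quotient_coords (\<pi> n) (\<mu> n) ?f ?s < \<bar>C\<bar> + 1" by blast
    then show ?case by (simp add: quotient_coords_def)
  qed
  then show ?thesis using that[of "\<bar>C\<bar> + 1"] by simp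
qed

text \<open>A quotient of the limit that misses \<open>L\<close> can be replaced by a nearby one that comes from a clopen step
function. The pullbacks of this step function along \<open>\<Phi> n\<close> give quotients of the graphons in the sequence,
and these stay close to it along \<open>G\<close>, hence away from \<open>L\<close>.\<close>

lemma down_set_limit_subset:
  fixes N :: "'b::t2_space measure"
  assumes graphons: "\<And>n. square_graphon (M n) (\<pi> n) (\<mu> n)" and graphon: "square_graphon N \<pi>' \<mu>'"
    and N: "sets N = sigma_sets (space N) (clopen_subsets (space N))" and closed: "closed (space N)"
    and \<Phi>: "\<And>n. \<Phi> n \<in> M n \<rightarrow>\<^sub>M N"
    and G: "G \<le> sequentially" "G \<noteq> bot"
    and conv: "\<And>A. A \<in> clopen_subsets (space N) \<Longrightarrow>
      ((\<lambda>n. measure (\<pi> n) (\<Phi> n -` A \<inter> space (M n))) \<longlongrightarrow> measure \<pi>' A) G"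
    "\<And>A B. A \<in> clopen_subsets (space N) \<Longrightarrow> B \<in> clopen_subsets (space N) \<Longrightarrow>
      ((\<lambda>n. measure (\<mu> n) ((\<Phi> n -` A \<inter> space (M n)) \<times> (\<Phi> n -` B \<inter> space (M n)))) \<longlongrightarrow> measure \<mu>' (A \<times> B)) G"
    and lim: "limitin (shape_space k) (\<lambda>n. shape k (M n) (\<pi> n) (\<mu> n)) L sequentially" and k: "1 \<le> k"
  shows "down_set k N \<pi>' \<mu>' \<subseteq> L"
proof
  fix y assume y: "y \<in> down_set k N \<pi>' \<mu>'"
  then have "total_coords y \<in> quotient_coords \<pi>' \<mu>' ` fractional_partitions k N"
    using total_coords_down_set[OF graphon] by blast
  then obtain f where f: "f \<in> fractional_partitions k N" "total_coords y = quotient_coords \<pi>' \<mu>' f"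
    by auto
  have "total_coords y \<in> total_coords ` L"
  proof (rule ccontr)
    assume "\<not> ?thesis"
    from t3_space[OF shape_limit_compact(3)[OF lim] this]
    obtain U V where UV: "open U" "open V" "total_coords y \<in> U" "total_coords ` L \<subseteq> V" "U \<inter> V = {}"
      by (elim exE conjE)
    obtain e where e: "0 < e" "\<And>v. (\<And>s. \<bar>v s - total_coords y s\<bar> < e) \<Longrightarrow> v \<in> U"
      using open_contains_sup_ball[OF UV(1,3)] by blast
    obtain m u q where q: "\<And>j. j < m \<Longrightarrow> u j \<in> stochastic_vectors k"
      "\<And>y. y \<in> space N \<Longrightarrow> q y < (m :: nat)" "\<And>j. q -` {j} \<inter> space N \<in> clopen_subsets (space N)"
      "q \<in> N \<rightarrow>\<^sub>M count_space UNIV"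
      "\<And>s. \<bar>quotient_coords \<pi>' \<mu>' f s - quotient_coords \<pi>' \<mu>' (\<lambda>y. u (q y)) s\<bar> < e"
      by (rule approximate_by_clopen_step[OF graphon N closed f(1) k e(1)]) (rule that)
    have "((\<lambda>n. quotient_coords (\<pi> n) (\<mu> n) (\<lambda>x. u (q (\<Phi> n x)))) \<longlongrightarrow>
        quotient_coords \<pi>' \<mu>' (\<lambda>y. u (q y))) G"
      using q(2,3)
      by (intro quotient_coords_step_tendsto[where \<A> = "clopen_subsets (space N)" and m = m,
            OF graphons graphon \<Phi>]) (simp_all add: q(4) conv)
    moreover have "quotient_coords \<pi>' \<mu>' (\<lambda>y. u (q y)) \<in> U"
      using q(5) f(2) by (intro e(2)) (simp add: abs_minus_commute)
    ultimately have "\<forall>\<^sub>F n in G. quotient_coords (\<pi> n) (\<mu> n) (\<lambda>x. u (q (\<Phi> n x))) \<in> U"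
      using UV(1) by (simp add: tendsto_def)
    moreover have "\<forall>\<^sub>F n in G. \<forall>f\<in>fractional_partitions k (M n). quotient_coords (\<pi> n) (\<mu> n) f \<in> V"
      by (rule filter_leD[OF G(1) shape_limit_miss[OF graphons lim UV(2,4)]])
    ultimately have "\<forall>\<^sub>F n in G. False"
    proof eventually_elim
      case (elim n)
      have "(\<lambda>x. u (q (\<Phi> n x))) \<in> fractional_partitions k (M n)"
        using measurable_space[OF \<Phi>[of n]] q(1,2)
        by (intro step_fractional_partition[of _ _ m] measurable_compose[OF \<Phi> q(4)]) auto
      with elim UV(5) show ?case by blast
    qed
    with G(2) show False by (simp add: trivial_limit_def)
  qed
  then show "y \<in> L"
    using inj_on_image_mem_iff[OF inj_on_total_coords _ shape_limit_compact(2)[OF lim]] y down_set_subset[of k N] by blast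
qed

theorem theorem4p5:
  fixes M :: "nat \<Rightarrow> 'a measure"
    and \<pi> :: "nat \<Rightarrow> 'a measure"
    and \<mu> :: "nat \<Rightarrow> ('a \<times> 'a) measure"
  assumes graphons: "\<And>n. square_graphon (M n) (\<pi> n) (\<mu> n)"
    and convergent: "\<And>k. k \<ge> 1 \<Longrightarrow>
      \<exists>L. limitin (shape_space k) (\<lambda>n. shape k (M n) (\<pi> n) (\<mu> n)) L sequentially"
  shows "\<exists>(N :: (nat \<Rightarrow> real) measure) \<pi>' \<mu>'.
    square_graphon N \<pi>' \<mu>' \<and>
    (\<forall>k\<ge>1. limitin (shape_space k) (\<lambda>n. shape k (M n) (\<pi> n) (\<mu> n))
       (shape k N \<pi>' \<mu>') sequentially)"
proof -
  obtain L where L: "\<And>k. k \<ge> 1 \<Longrightarrow>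
      limitin (shape_space k) (\<lambda>n. shape k (M n) (\<pi> n) (\<mu> n)) (L k) sequentially"
    using convergent by metis
  obtain C where C: "\<forall>\<^sub>F n in sequentially. measure (\<mu> n) (space (\<mu> n)) \<le> C"
    using shape_limit_mass_bounded[OF graphons L[of 1]] by auto
  \<comment> \<open>Finite nets \<open>t a b\<close> of mesh \<open>1 / Suc b\<close> in the simplex with vertices \<open>{1..Suc a}\<close>; the shift
    keeps the simplex nonempty.\<close>
  have "\<exists>sz t. 0 < (sz :: nat) \<and> (\<forall>j<sz. t j \<in> stochastic_vectors (Suc a)) \<and>
      (\<forall>v\<in>stochastic_vectors (Suc a). \<exists>j<sz. \<forall>i. \<bar>v i - t j i\<bar> < 1 / Suc b)" for a b
    using stochastic_vectors_net[of "Suc a" "1 / Suc b"] by (metis le_add1 plus_1_eq_Suc of_nat_0_less_iff zero_less_Suc zero_less_divide_1_iff)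
  then obtain sz t where net: "\<And>a b. 0 < (sz a b :: nat)"
    "\<And>a b j. j < sz a b \<Longrightarrow> t a b j \<in> stochastic_vectors (Suc a)"
    "\<And>a b v. v \<in> stochastic_vectors (Suc a) \<Longrightarrow> \<exists>j<sz a b. \<forall>i. \<bar>v i - t a b j i\<bar> < 1 / Suc b"
    by metis
  obtain \<B> :: "(nat + nat \<times> nat \<Rightarrow> real) set set" where \<B>: "countable \<B>" "topological_basis \<B>"
    using ex_countable_basis by auto
  have \<B>_ne: "\<B> \<noteq> {}"
    using topological_basisE[OF \<B>(2) open_UNIV UNIV_I] by blast
  define E where "E c = from_nat_into \<B> c" for c
  have rangeE: "range E = \<B>"
    unfolding E_def using range_from_nat_into[OF \<B>_ne \<B>(1)] .
  \<comment> \<open>A natural number \<open>i\<close> encodes a dimension, a mesh and a basic open set, that is, one approximation task.\<close>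
  define dec where "dec = (from_nat :: nat \<Rightarrow> nat \<times> nat \<times> nat)"
  define len where "len i = (case dec i of (a, b, c) \<Rightarrow> sz a b)" for i
  define \<tau> where "\<tau> i = (case dec i of (a, b, c) \<Rightarrow> t a b)" for i
  define W where "W i = (case dec i of (a, b, c) \<Rightarrow> E c)" for i
  have len_pos: "0 < len i" for i using net(1) by (simp add: len_def split: prod.split)
  define good where "good n i p \<longleftrightarrow> p \<in> M n \<rightarrow>\<^sub>M count_space UNIV \<and> (\<forall>x\<in>space (M n). p x < len i) \<and>
      quotient_coords (\<pi> n) (\<mu> n) (\<lambda>x. \<tau> i (p x)) \<in> W i" for n i and p :: "'a \<Rightarrow> nat"
  \<comment> \<open>The \<open>n\<close>-th graphon solves task \<open>i\<close> by a partition, if it can, and otherwise takes the trivial one.\<close>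
  define p where "p n i = (if \<exists>p. good n i p then SOME p. good n i p else (\<lambda>_. 0))" for n i
  have p_good: "good n i (p n i)" if "good n i p'" for n i p'
  proof -
    have "\<exists>p. good n i p" using that by blast
    then show ?thesis unfolding p_def by (simp add: someI_ex)
  qed
  have p_meas: "p n i \<in> M n \<rightarrow>\<^sub>M count_space UNIV" and p_less: "x \<in> space (M n) \<Longrightarrow> p n i x < len i" for n i x
  proof -
    have "p n i \<in> M n \<rightarrow>\<^sub>M count_space UNIV \<and> (\<forall>x\<in>space (M n). p n i x < len i)"
    proof (cases "\<exists>p. good n i p")
      case True
      then have "good n i (p n i)" using p_good by blast
      then show ?thesis unfolding good_def by blast
    next
      case False
      then have "p n i = (\<lambda>_. 0)" unfolding p_def by (rule if_not_P)
      then show ?thesis using len_pos by simp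
    qed
    then show "p n i \<in> M n \<rightarrow>\<^sub>M count_space UNIV" "x \<in> space (M n) \<Longrightarrow> p n i x < len i"
      by blast+
  qed
  \<comment> \<open>All the partitions together map the \<open>n\<close>-th graphon into one product of finite sets.\<close>
  define S where "S i = real ` {..<len i}" for i
  define \<Omega> where "\<Omega> = Pi UNIV S"
  define \<Phi> where "\<Phi> n x = (\<lambda>i. real (p n i x))" for n x
  have \<Omega>: "compact \<Omega>"
    unfolding \<Omega>_def S_def by (intro compact_Pi_UNIV finite_imp_compact) simp
  have \<Phi>_meas: "\<Phi> n \<in> borel_measurable (M n)" for n
    unfolding \<Phi>_def
    by (intro measurable_coordinatewise_then_product measurable_compose[OF p_meas]) simp
  have \<Phi>_in: "\<Phi> n x \<in> \<Omega>" if "x \<in> space (M n)" for n x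
    using p_less[OF that] by (auto simp: \<Omega>_def S_def \<Phi>_def)
  obtain G and N \<pi>' :: "(nat \<Rightarrow> real) measure" and \<mu>' where G: "G \<le> sequentially" "G \<noteq> bot"
    and graphon: "square_graphon N \<pi>' \<mu>'"
    and N: "space N = \<Omega>" "sets N = sigma_sets \<Omega> (clopen_subsets \<Omega>)"
    and \<Phi>N: "\<And>n. \<Phi> n \<in> M n \<rightarrow>\<^sub>M N"
    and conv: "\<And>A. A \<in> clopen_subsets \<Omega> \<Longrightarrow>
      ((\<lambda>n. measure (\<pi> n) (\<Phi> n -` A \<inter> space (M n))) \<longlongrightarrow> measure \<pi>' A) G"
    "\<And>A B. A \<in> clopen_subsets \<Omega> \<Longrightarrow> B \<in> clopen_subsets \<Omega> \<Longrightarrow>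
      ((\<lambda>n. measure (\<mu> n) ((\<Phi> n -` A \<inter> space (M n)) \<times> (\<Phi> n -` B \<inter> space (M n)))) \<longlongrightarrow> measure \<mu>' (A \<times> B)) G"
    by (rule limit_graphon_exists[OF graphons C \<Omega> \<Phi>_meas \<Phi>_in]) (assumption, rule that)
  have step_tendsto: "((\<lambda>n. quotient_coords (\<pi> n) (\<mu> n) (\<lambda>x. u (q (\<Phi> n x)))) \<longlongrightarrow>
      quotient_coords \<pi>' \<mu>' (\<lambda>y. u (q y))) G"
    if "q \<in> N \<rightarrow>\<^sub>M count_space UNIV" "\<And>y. y \<in> \<Omega> \<Longrightarrow> q y < m" "\<And>j. q -` {j} \<inter> \<Omega> \<in> clopen_subsets \<Omega>"
    for q :: "(nat \<Rightarrow> real) \<Rightarrow> nat" and m u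
    using that
    by (intro quotient_coords_step_tendsto[where \<A> = "clopen_subsets \<Omega>" and m = m, OF graphons graphon \<Phi>N])
       (simp_all add: N(1) conv)
  note L_fin = shape_limit_compact(2)[OF L]
  have sub: "down_set k N \<pi>' \<mu>' \<subseteq> L k" if k: "k \<ge> 1" for k
    using N \<Omega> conv
    by (intro down_set_limit_subset[OF graphons graphon _ _ \<Phi>N G _ _ L[OF k] k])
       (simp_all add: compact_imp_closed)
  have sup: "L k \<subseteq> shape k N \<pi>' \<mu>'" if k: "k \<ge> 1" for k
  proof
    fix d assume d: "d \<in> L k"
    let ?\<delta> = "total_coords d" and ?I = "coord_index k"
    note box = open_sup_box[OF finite_coord_index[of k]]
    have d_fin: "d \<in> fin_graphons k" using L_fin[OF k] d by blast
    obtain a where a: "k = Suc a" using k by (cases k) auto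
    show "d \<in> shape k N \<pi>' \<mu>'"
      unfolding shape_def in_closure_of topspace_fin_graphon_topology
    proof (intro conjI allI impI; (elim conjE)?)
      show "d \<in> fin_graphons k" by fact
      fix T assume T: "d \<in> T" "openin (fin_graphon_topology k) T"
      then obtain V where V: "open V" "T = total_coords -` V \<inter> fin_graphons k"
        by (auto simp: fin_graphon_topology_eq openin_pullback_topology)
      then have "?\<delta> \<in> V" using T(1) by simp
      then obtain e where e: "0 < e" "\<And>v. (\<And>s. \<bar>v s - ?\<delta> s\<bar> < e) \<Longrightarrow> v \<in> V"
        using open_contains_sup_ball[OF V(1)] by blast
      \<comment> \<open>Only finitely many coordinates are constrained, so that the box is open; the other
        coordinates vanish for all graphons on \<open>[k]\<close>. The factor \<open>1/2\<close> leaves room for passing to the limit.\<close>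
      have "?\<delta> \<in> {v. \<forall>s\<in>?I. \<bar>v s - ?\<delta> s\<bar> < e / 2}" using e(1) by simp
      then obtain B where B: "B \<in> \<B>" "?\<delta> \<in> B" "B \<subseteq> {v. \<forall>s\<in>?I. \<bar>v s - ?\<delta> s\<bar> < e / 2}"
        using topological_basisE[OF \<B>(2) box] by blast
      then obtain c where c: "E c = B" using rangeE by blast
      obtain e2 where e2: "0 < e2" "\<And>v. (\<And>s. \<bar>v s - ?\<delta> s\<bar> < e2) \<Longrightarrow> v \<in> B"
        using open_contains_sup_ball[OF topological_basis_open[OF \<B>(2) B(1)] B(2)] by blast
      \<comment> \<open>The mesh is chosen such that rounding moves no coordinate by \<open>e2 / 2\<close> or more.\<close>
      obtain b where b: "(1 + 2 * C) * (1 / Suc b) < e2 / 2"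
      proof -
        obtain b where "2 * (1 + 2 * C) / e2 < real b" using reals_Archimedean2 by blast
        then have "2 * (1 + 2 * C) < e2 * real (Suc b)" using e2(1) by (simp add: field_simps)
        then have "(1 + 2 * C) * (1 / Suc b) < e2 / 2" by (simp add: field_simps)
        then show ?thesis by (rule that)
      qed
      define i where "i = to_nat (a, b, c)"
      have i: "len i = sz a b" "\<tau> i = t a b" "W i = B"
        using c by (simp_all add: len_def \<tau>_def W_def dec_def i_def)
      have "\<forall>\<^sub>F n in sequentially. \<exists>f\<in>fractional_partitions k (M n).
          quotient_coords (\<pi> n) (\<mu> n) f \<in> {v. \<forall>s\<in>?I. \<bar>v s - ?\<delta> s\<bar> < e2 / 2}"
        using e2(1) by (intro shape_limit_hit[OF graphons L[OF k] box d]) simp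
      with C have "\<forall>\<^sub>F n in sequentially. good n i (p n i)"
      proof eventually_elim
        case (elim n)
        then obtain f where f: "f \<in> fractional_partitions k (M n)"
          "\<And>s. s \<in> ?I \<Longrightarrow> \<bar>quotient_coords (\<pi> n) (\<mu> n) f s - ?\<delta> s\<bar> < e2 / 2"
          by auto
        obtain r where r: "r \<in> M n \<rightarrow>\<^sub>M count_space (UNIV :: nat set)" "\<And>x. x \<in> space (M n) \<Longrightarrow> r x < sz a b"
          "\<And>x i. x \<in> space (M n) \<Longrightarrow> \<bar>f x i - t a b (r x) i\<bar> < 1 / Suc b"
          using fractional_partition_step_approx[OF f(1)[unfolded a] net(3)] by blast
        have tr: "(\<lambda>x. t a b (r x)) \<in> fractional_partitions k (M n)"
          unfolding a using r(1,2) net(2) by (rule step_fractional_partition)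
        have "\<bar>quotient_coords (\<pi> n) (\<mu> n) (\<lambda>x. t a b (r x)) s - ?\<delta> s\<bar> < e2" for s
        proof (cases "s \<in> ?I")
          case True
          have "\<bar>quotient_coords (\<pi> n) (\<mu> n) f s - quotient_coords (\<pi> n) (\<mu> n) (\<lambda>x. t a b (r x)) s\<bar> \<le>
              (1 + 2 * measure (\<mu> n) (space (\<mu> n))) * (1 / Suc b)"
            using quotient_coords_close[OF graphons f(1) tr sets.empty_sets, of "1 / Suc b" s] r(3)
            by (simp add: less_imp_le)
          also have "\<dots> \<le> (1 + 2 * C) * (1 / Suc b)"
            using elim(1) by (intro mult_right_mono) simp_all
          also have "\<dots> < e2 / 2" by (rule b)
          finally show ?thesis using f(2)[OF True] by linarith
        next
          case False
          then show ?thesis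
            using quotient_coords_outside[OF graphons tr False] total_coords_outside[OF d_fin False] e2(1) by simp
        qed
        then have "good n i r"
          unfolding good_def i using r(1,2) e2(2) by blast
        then show ?case by (rule p_good)
      qed
      then have "\<forall>\<^sub>F n in G. good n i (p n i)"
        by (rule filter_leD[OF G(1)])
      then have near: "\<forall>\<^sub>F n in G. \<bar>quotient_coords (\<pi> n) (\<mu> n) (\<lambda>x. \<tau> i (p n i x)) s - ?\<delta> s\<bar> \<le> e / 2" if "s \<in> ?I" for s
      proof eventually_elim
        case (elim n)
        then show ?case using B(3) i(3) that by (auto simp: good_def intro!: less_imp_le)
      qed
      \<comment> \<open>The coordinate projection that decodes the \<open>i\<close>-th partition on the limit space.\<close>
      define q where "q y = nat \<lfloor>y i\<rfloor>" for y :: "nat \<Rightarrow> real"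
      have q\<Phi>: "q (\<Phi> n x) = p n i x" for n x by (simp add: q_def \<Phi>_def)
      have q_less: "q y < len i" if "y \<in> \<Omega>" for y
      proof -
        have "y i \<in> S i" using that by (auto simp: \<Omega>_def)
        then show ?thesis by (auto simp: S_def q_def)
      qed
      have q_clopen: "q -` {j} \<inter> \<Omega> \<in> clopen_subsets \<Omega>" for j
      proof -
        have "q -` {j} \<inter> \<Omega> = {y \<in> Pi UNIV S. y i \<in> {r. nat \<lfloor>r\<rfloor> = j}}"
          by (auto simp: q_def \<Omega>_def)
        also have "\<dots> \<in> clopen_subsets (Pi UNIV S)"
          by (rule clopen_subsets_coordinate) (simp add: S_def)
        finally show ?thesis by (simp add: \<Omega>_def)
      qed
      have q_meas: "q \<in> N \<rightarrow>\<^sub>M count_space UNIV"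
        using q_clopen by (subst measurable_count_space_eq2_countable) (auto simp: N intro: sigma_sets.Basic)
      have lim: "((\<lambda>n. quotient_coords (\<pi> n) (\<mu> n) (\<lambda>x. \<tau> i (p n i x))) \<longlongrightarrow>
          quotient_coords \<pi>' \<mu>' (\<lambda>y. \<tau> i (q y))) G"
        using step_tendsto[OF q_meas q_less q_clopen, of "\<tau> i"] by (simp add: q\<Phi>)
      have \<tau>q: "(\<lambda>y. \<tau> i (q y)) \<in> fractional_partitions k N"
        unfolding a using q_meas q_less net(2) by (intro step_fractional_partition[of q N "len i"]) (auto simp: N(1) i)
      have "\<bar>quotient_coords \<pi>' \<mu>' (\<lambda>y. \<tau> i (q y)) s - ?\<delta> s\<bar> < e" for s
      proof (cases "s \<in> ?I")
        case True
        have "((\<lambda>n. quotient_coords (\<pi> n) (\<mu> n) (\<lambda>x. \<tau> i (p n i x)) s) \<longlongrightarrow>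
            quotient_coords \<pi>' \<mu>' (\<lambda>y. \<tau> i (q y)) s) G"
          using continuous_on_tendsto_compose[OF continuous_on_product_coordinates[of s] lim] by simp
        then have "((\<lambda>n. \<bar>quotient_coords (\<pi> n) (\<mu> n) (\<lambda>x. \<tau> i (p n i x)) s - ?\<delta> s\<bar>) \<longlongrightarrow>
            \<bar>quotient_coords \<pi>' \<mu>' (\<lambda>y. \<tau> i (q y)) s - ?\<delta> s\<bar>) G"
          by (intro tendsto_intros)
        then have "\<bar>quotient_coords \<pi>' \<mu>' (\<lambda>y. \<tau> i (q y)) s - ?\<delta> s\<bar> \<le> e / 2"
          using near[OF True] G(2) by (rule tendsto_upperbound)
        with e(1) show ?thesis by linarith
      next
        case False
        then show ?thesis
          using quotient_coords_outside[OF graphon \<tau>q False] total_coords_outside[OF d_fin False] e(1) by simp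
      qed
      then have "quotient_coords \<pi>' \<mu>' (\<lambda>y. \<tau> i (q y)) \<in> V" by (rule e(2))
      moreover have "quotient_coords \<pi>' \<mu>' (\<lambda>y. \<tau> i (q y)) \<in> total_coords ` down_set k N \<pi>' \<mu>'"
        using \<tau>q by (simp add: total_coords_down_set[OF graphon])
      ultimately obtain y where "y \<in> down_set k N \<pi>' \<mu>'" "total_coords y \<in> V" by auto
      then show "\<exists>y. y \<in> down_set k N \<pi>' \<mu>' \<and> y \<in> T"
        using V(2) down_set_subset[of k N] by blast
    qed
  qed
  have "shape k N \<pi>' \<mu>' = L k" if k: "k \<ge> 1" for k
  proof
    have "closedin (fin_graphon_topology k) (L k)"
      using shape_limit_compact(2,3)[OF L[OF k]] by (intro closedin_fin_graphon_topology)
    then show "shape k N \<pi>' \<mu>' \<subseteq> L k"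
      unfolding shape_def by (rule closure_of_minimal[OF sub[OF k]])
  qed (rule sup[OF k])
  then have "\<forall>k\<ge>1. limitin (shape_space k) (\<lambda>n. shape k (M n) (\<pi> n) (\<mu> n)) (shape k N \<pi>' \<mu>') sequentially"
    using L by simp
  with graphon show ?thesis by blast
qed

end
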